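(* Consider a mechanical system $\mathbf M\ddot y+\mathbf C\dot y+\mathbf K y+f(y,\dot y)=\epsilon\,g(\Omega t,y,\dot y)$, $0\le\epsilon\ll1$, subject to periodic external and parametric excitation with frequency $\Omega$, and with no (near) internal resonances in its spectrum. Assume that a harmonic $\kappa_0\in\mathbb Z^*$ of the excitation is in near-resonance with the $j$-th linear mode, i.e. $i\kappa_0\Omega\approx\lambda_j$ for some $j$. Consider the two-dimensional spectral submanifold (SSM) that is the non-autonomous, nonlinear continuation of the $j$-th linear mode, with its reduced dynamics (coefficients $R^1_m$, $S^1_{m,\kappa}$, described in the context) computed in a normal-form style of parametrization. Then the following hold. (i) (Polar dynamics) The reduced dynamics in polar coordinates $(\rho,\theta)$, $p=\rho e^{i\theta}$, is given by $$\begin{bmatrix}\dot\rho\\ \rho\dot\psi\end{bmatrix}=r(\rho,\psi,\Omega),\qquad \dot\phi=\Omega,$$ where $\psi=\theta-\kappa_0\phi$, $$r(\rho,\psi,\Omega)=\begin{bmatrix}a(\rho)\\ b(\rho,\Omega)\end{bmatrix}+\epsilon\Big(Q(\psi)\begin{bmatrix}\mathrm{Re}\,S^1_{0,\kappa_0}\\ \mathrm{Im}\,S^1_{0,\kappa_0}\end{bmatrix}+\sum_{m\in\mathbb N^2\setminus\{0\},\ \kappa\in\mathbb Z^*}\rho^{|m|}\,Q\big((\kappa/\kappa_0)\psi\big)\begin{bmatrix}\mathrm{Re}\,S^1_{m,\kappa}\\ \mathrm{Im}\,S^1_{m,\kappa}\end{bmatrix}\Big),$$ $$a(\rho)=\mathrm{Re}\Big(\sum_mR^1_m\rho^{|m|}\Big),\qquad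 b(\rho,\Omega)=\mathrm{Im}\Big(\sum_mR^1_m\rho^{|m|}\Big)-\kappa_0\,\rho\,\Omega,\qquad Q(\alpha)=\begin{bmatrix}\cos\alpha&\sin\alpha\\-\sin\alpha&\cos\alpha\end{bmatrix},$$ and the sum over $\kappa$ and $m$ includes the harmonics and multi-indices associated with nonzero reduced-dynamics coefficients in the normal-form style of parametrization. (ii) (Forced response curve) The fixed points of the SSM-reduced polar dynamics lie on the forced response curve that satisfies $r(\rho,\psi,\Omega)=0$. (iii) (Stability of the forced response) For any hyperbolic fixed point $(\rho,\psi)$ of the polar dynamics in (i), the eigenvalues of the Jacobian $$J=\begin{bmatrix}\partial_\rho a(\rho)&0\\ \partial_\rho\big(b(\rho,\Omega)/\rho\big)&0\end{bmatrix}+\epsilon\Big(\begin{bmatrix}0&d_{0,\kappa_0}(\psi)\\ -\frac{d_{0,\kappa_0}(\psi)}{\rho^2}&-\frac{c_{0,\kappa_0}(\psi)}{\rho}\end{bmatrix}+\sum_{m\in\mathbb N^2\setminus\{0\},\ \kappa\in\mathbb Z^*}\begin{bmatrix}c_{m,\kappa}(\psi)\,|m|\,\rho^{|m|-1}&(\kappa/\kappa_0)\,d_{m,\kappa}(\psi)\,\rho^{|m|}\\ d_{m,\kappa}(\psi)\,(|m|-1)\,\rho^{|m|-2}&-(\kappa/\kappa_0)\,c_{m,\kappa}(\psi)\,\rho^{|m|-1}\end{bmatrix}\Big)$$ determine the stability of the fixed point, where $$c_{m,\kappa}(\psi)=\mathrm{Re}(S^1_{m,\kappa})\cos((\kappa/\kappa_0)\psi)+\mathrm{Im}(S^1_{m,\kappa})\sin((\kappa/\kappa_0)\psi),$$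 $$d_{m,\kappa}(\psi)=-\mathrm{Re}(S^1_{m,\kappa})\sin((\kappa/\kappa_0)\psi)+\mathrm{Im}(S^1_{m,\kappa})\cos((\kappa/\kappa_0)\psi).$$
   Context: Here $y\in\mathbb R^n$; $\mathbf M,\mathbf C,\mathbf K$ are the mass, damping and stiffness matrices; $f$ is the nonlinearity; and $g(\phi,y,\dot y)=f_{\rm ext}(\phi)+f_{\rm param}(\phi,y,\dot y)$ is the sum of external and parametric excitation, periodic in the phase $\phi=\Omega t$. The numbers $\lambda_j,\bar\lambda_j$ are the eigenvalue pair of the $j$-th mode of the linear unforced system, i.e. solutions of $(\lambda^2\mathbf M+\lambda\mathbf C+\mathbf K)\varphi=0$ with $\varphi\ne0$. $\mathbb N$ includes $0$, $\mathbb Z^*=\mathbb Z\setminus\{0\}$, and $|m|=m_1+m_2$ for $m=(m_1,m_2)\in\mathbb N^2$. The SSM is an invariant manifold of the forced system in the phase space $z=(y,\dot y)$, periodic in $\phi$, that perturbs smoothly from the two-dimensional modal subspace with eigenvalues $\lambda_j,\bar\lambda_j$ under addition of the nonlinearity and the $\mathcal O(\epsilon)$ excitation. It is parametrized as $z=W_\epsilon(p,\bar p,\phi)$ with complex coordinates $(p,\bar p)$. Its reduced dynamics, up to first order in $\epsilon$, is $$\dot p=\sum_{m\in\mathbb N^2}R^1_m\,p^{m_1}\bar p^{\,m_2}+\epsilon\sum_{m\in\mathbb N^2,\ \kappa\in\mathbb Z^*}S^1_{m,\kappa}\,e^{i\kappa\phi}\,p^{m_1}\bar p^{\,m_2},\qquad\dot\phi=\Omega,$$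 together with the complex conjugate equation, where $R^1_m,S^1_{m,\kappa}\in\mathbb C$. Normal-form style of parametrization: with $\lambda=\lambda_j$, the coefficient $R^1_m$ is nonzero only for multi-indices satisfying the near-resonance $\lambda\approx m_1\lambda+m_2\bar\lambda$, and $S^1_{m,\kappa}$ is nonzero only for pairs $(m,\kappa)$ satisfying the near-resonance $\lambda\approx m_1\lambda+m_2\bar\lambda+i\kappa\Omega$. *)

theory Defs
  imports "HOL-Analysis.Analysis" "HOL-Computational_Algebra.Polynomial"
begin

section \<open>Mechanical system and its linear spectrum\<close>

definition cmat :: "real^'n^'m \<Rightarrow> complex^'n^'m" where
  "cmat A = (\<chi> i j. complex_of_real (A $ i $ j))"

definition mech_eigenpair ::
  "real^'n^'n \<Rightarrow> real^'n^'n \<Rightarrow> real^'n^'n \<Rightarrow> complex \<Rightarrow> complex^'n \<Rightarrow> bool" where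
  "mech_eigenpair M C K lam v \<longleftrightarrow> v \<noteq> 0 \<and>
     (lam\<^sup>2) *s (cmat M *v v) + lam *s (cmat C *v v) + cmat K *v v = 0"

text \<open>The quadratic matrix pencil as a matrix of polynomials; root orders of its determinant
  are the algebraic multiplicities of the eigenvalues.\<close>

definition mech_charpoly ::
  "real^'n^'n \<Rightarrow> real^'n^'n \<Rightarrow> real^'n^'n \<Rightarrow> complex poly" where
  "mech_charpoly M C K =
     det (\<chi> i j. [:of_real (K $ i $ j), of_real (C $ i $ j), of_real (M $ i $ j):])"

text \<open>The equation \<open>M y'' + C y' + K y + f(y, y') = \<epsilon> g(\<phi>, y, y')\<close> as a relation between a phase
  \<open>\<phi>\<close>, a point \<open>z = (y, v)\<close> of the phase space and the velocity \<open>(y', v')\<close> there.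
  The mass matrix is kept on the left, so that its inverse is not needed.\<close>

definition mech_system ::
  "real^'n^'n \<Rightarrow> real^'n^'n \<Rightarrow> real^'n^'n \<Rightarrow> (real^'n \<Rightarrow> real^'n \<Rightarrow> real^'n) \<Rightarrow>
   (real \<Rightarrow> real^'n \<Rightarrow> real^'n \<Rightarrow> real^'n) \<Rightarrow> real \<Rightarrow> real \<Rightarrow>
   (real^'n) \<times> (real^'n) \<Rightarrow> (real^'n) \<times> (real^'n) \<Rightarrow> bool" where
  "mech_system M C K f g \<epsilon> \<phi> z z' \<longleftrightarrow>
     fst z' = snd z \<and>
     M *v snd z' + C *v snd z + K *v fst z + f (fst z) (snd z) = \<epsilon> *\<^sub>R g \<phi> (fst z) (snd z)"

definition purely_nonlinear :: "(real^'n \<Rightarrow> real^'n \<Rightarrow> real^'n) \<Rightarrow> bool" where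
  "purely_nonlinear f \<longleftrightarrow> f 0 0 = 0 \<and> ((\<lambda>(y, v). f y v) has_derivative (\<lambda>_. 0)) (at (0, 0))"


section \<open>Near-resonances\<close>

text \<open>Multi-indices \<open>m = (m\<^sub>1, m\<^sub>2)\<close> are pairs of naturals.\<close>

definition msize :: "nat \<times> nat \<Rightarrow> nat" where
  "msize m = fst m + snd m"

text \<open>The relation \<open>\<mu> \<approx> m\<^sub>1 lam + m\<^sub>2 cnj lam + i \<kappa> \<Omega>\<close>: the frequencies (imaginary parts) agree up to
  \<open>\<delta>\<close>, the growth rates (real parts) up to \<open>\<eta> |m|\<close>. The tolerance for the real parts may depend on
  the order because for a lightly damped mode the mismatch of \<open>lam \<approx> (l+1) lam + l cnj lam\<close> is
  \<open>2 l |Re lam|\<close>, and this counts as a near-resonance for every \<open>l\<close>. A constant \<open>\<eta>\<close> is the usual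
  closeness of complex numbers. The relation \<open>lam \<approx> i \<kappa> \<Omega>\<close> is the case \<open>m = 0\<close>.\<close>

definition near_resonant ::
  "(nat \<Rightarrow> real) \<Rightarrow> real \<Rightarrow> complex \<Rightarrow> complex \<Rightarrow> real \<Rightarrow> nat \<times> nat \<Rightarrow> int \<Rightarrow> bool" where
  "near_resonant \<eta> \<delta> \<mu> lam \<Omega> m \<kappa> \<longleftrightarrow>
     (let d = \<mu> - (of_nat (fst m) * lam + of_nat (snd m) * cnj lam + \<i> * of_int \<kappa> * of_real \<Omega>)
      in \<bar>Re d\<bar> \<le> \<eta> (msize m) \<and> \<bar>Im d\<bar> \<le> \<delta>)"

definition no_internal_resonance ::
  "(nat \<Rightarrow> real) \<Rightarrow> real \<Rightarrow> real^'n^'n \<Rightarrow> real^'n^'n \<Rightarrow> real^'n^'n \<Rightarrow> complex \<Rightarrow> bool" where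
  "no_internal_resonance \<eta> \<delta> M C K lam \<longleftrightarrow>
     order lam (mech_charpoly M C K) = 1 \<and>
     (\<forall>\<mu> v m. mech_eigenpair M C K \<mu> v \<and> \<mu> \<notin> {lam, cnj lam} \<and> m \<noteq> (0, 0) \<longrightarrow>
        \<not> near_resonant \<eta> \<delta> \<mu> lam 0 m 0)"

text \<open>\<open>R m\<close> and \<open>S m \<kappa>\<close> stand for the coefficients \<open>R\<^sup>1\<^sub>m\<close> and \<open>S\<^sup>1\<^sub>m\<^sub>,\<^sub>\<kappa>\<close>.\<close>

definition normal_form_style ::
  "(nat \<Rightarrow> real) \<Rightarrow> real \<Rightarrow> complex \<Rightarrow> real \<Rightarrow> (nat \<times> nat \<Rightarrow> complex) \<Rightarrow>
   (nat \<times> nat \<Rightarrow> int \<Rightarrow> complex) \<Rightarrow> bool" where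
  "normal_form_style \<eta> \<delta> lam \<Omega> R S \<longleftrightarrow>
     (\<forall>m. R m \<noteq> 0 \<longrightarrow> near_resonant \<eta> \<delta> lam lam \<Omega> m 0) \<and>
     (\<forall>m \<kappa>. \<kappa> \<noteq> 0 \<and> S m \<kappa> \<noteq> 0 \<longrightarrow> near_resonant \<eta> \<delta> lam lam \<Omega> m \<kappa>)"

text \<open>Near-equality is transitive and compatible with integer multiples only up to accumulated
  errors. Combining \<open>lam \<approx> i \<kappa>\<^sub>0 \<Omega>\<close>, taken \<open>|1 - m\<^sub>1 + m\<^sub>2|\<close> times, with
  \<open>lam \<approx> m\<^sub>1 lam + m\<^sub>2 cnj lam + i \<kappa> \<Omega>\<close> gives a frequency error of at most
  \<open>(1 + |1 - m\<^sub>1 + m\<^sub>2|) \<delta>\<close>. It has to be smaller than the spacing \<open>\<Omega>\<close> of the harmonics for \<open>m = 0\<close>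
  and for every \<open>m\<close> that occurs in the non-autonomous part.\<close>

definition small_tolerance ::
  "real \<Rightarrow> real \<Rightarrow> (nat \<times> nat \<Rightarrow> int \<Rightarrow> complex) \<Rightarrow> bool" where
  "small_tolerance \<delta> \<Omega> S \<longleftrightarrow> 2 * \<delta> < \<Omega> \<and>
     (\<forall>m \<kappa>. \<kappa> \<noteq> 0 \<and> S m \<kappa> \<noteq> 0 \<longrightarrow> (1 + \<bar>1 - real (fst m) + real (snd m)\<bar>) * \<delta> < \<Omega>)"


section \<open>Spectral submanifold and reduced dynamics\<close>

definition C1_on :: "'a::real_normed_vector set \<Rightarrow> ('a \<Rightarrow> 'b::real_normed_vector) \<Rightarrow> bool" where
  "C1_on D F \<longleftrightarrow> (\<exists>F'. (\<forall>x\<in>D. (F has_derivative blinfun_apply (F' x)) (at x within D)) \<and>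
     continuous_on D F')"

text \<open>Real parametrization \<open>p w + cnj p cnj w\<close> of the modal subspace of the phase space, for the
  eigenvector \<open>w = (v, lam v)\<close> of the first-order system.\<close>

definition modal_subspace_map ::
  "complex \<Rightarrow> complex^'n \<Rightarrow> complex \<Rightarrow> (real^'n) \<times> (real^'n)" where
  "modal_subspace_map lam v p =
     ((\<chi> i. 2 * Re (p * v $ i)), (\<chi> i. 2 * Re (p * (lam * v $ i))))"

text \<open>\<open>W \<epsilon> p \<phi>\<close> is the parametrization \<open>W\<^sub>\<epsilon>(p, cnj p, \<phi>)\<close> and \<open>P \<epsilon> p \<phi>\<close> the full reduced vector field
  \<open>p'\<close> for \<open>0 \<le> \<epsilon> \<le> \<epsilon>\<^sub>0\<close> and \<open>|p| < r\<close>. The third-to-last clause is tangency of the autonomous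
  manifold to the modal subspace; the last one says that the manifold is immersed and that the
  vector field \<open>(P, \<Omega>)\<close> is mapped by the derivative of \<open>W\<close> to that of the mechanical system
  (invariance equation).\<close>

definition is_SSM ::
  "real^'n^'n \<Rightarrow> real^'n^'n \<Rightarrow> real^'n^'n \<Rightarrow> (real^'n \<Rightarrow> real^'n \<Rightarrow> real^'n) \<Rightarrow>
   (real \<Rightarrow> real^'n \<Rightarrow> real^'n \<Rightarrow> real^'n) \<Rightarrow> real \<Rightarrow> complex \<Rightarrow> complex^'n \<Rightarrow> real \<Rightarrow> real \<Rightarrow>
   (real \<Rightarrow> complex \<Rightarrow> real \<Rightarrow> (real^'n) \<times> (real^'n)) \<Rightarrow>
   (real \<Rightarrow> complex \<Rightarrow> real \<Rightarrow> complex) \<Rightarrow> bool" where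
  "is_SSM M C K f g \<Omega> lam v \<epsilon>\<^sub>0 r W P \<longleftrightarrow>
     0 < \<epsilon>\<^sub>0 \<and> 0 < r \<and>
     C1_on ({0..\<epsilon>\<^sub>0} \<times> ball 0 r \<times> UNIV) (\<lambda>(\<epsilon>, p, \<phi>). W \<epsilon> p \<phi>) \<and>
     C1_on ({0..\<epsilon>\<^sub>0} \<times> ball 0 r \<times> UNIV) (\<lambda>(\<epsilon>, p, \<phi>). P \<epsilon> p \<phi>) \<and>
     (\<forall>\<epsilon>\<in>{0..\<epsilon>\<^sub>0}. \<forall>p\<in>ball 0 r. \<forall>\<phi>.
        W \<epsilon> p (\<phi> + 2 * pi) = W \<epsilon> p \<phi> \<and> P \<epsilon> p (\<phi> + 2 * pi) = P \<epsilon> p \<phi>) \<and>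
     (\<forall>p\<in>ball 0 r. \<forall>\<phi>. W 0 p \<phi> = W 0 p 0) \<and> W 0 0 0 = 0 \<and>
     ((\<lambda>p. W 0 p 0) has_derivative modal_subspace_map lam v) (at 0) \<and>
     (\<forall>\<epsilon>\<in>{0..\<epsilon>\<^sub>0}. \<forall>\<phi>. inj_on (\<lambda>p. W \<epsilon> p \<phi>) (ball 0 r)) \<and>
     (\<forall>\<epsilon>\<in>{0..\<epsilon>\<^sub>0}. \<forall>p\<in>ball 0 r. \<forall>\<phi>. \<exists>D.
        ((\<lambda>(q, \<tau>). W \<epsilon> q \<tau>) has_derivative D) (at (p, \<phi>)) \<and>
        inj (\<lambda>h. D (h, 0)) \<and>
        mech_system M C K f g \<epsilon> \<phi> (W \<epsilon> p \<phi>) (D (P \<epsilon> p \<phi>, \<Omega>)))"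

definition R_series :: "(nat \<times> nat \<Rightarrow> complex) \<Rightarrow> complex \<Rightarrow> complex" where
  "R_series R p = (\<Sum>\<^sub>\<infinity>m\<in>UNIV. R m * p ^ fst m * cnj p ^ snd m)"

definition S_series :: "(nat \<times> nat \<Rightarrow> int \<Rightarrow> complex) \<Rightarrow> complex \<Rightarrow> real \<Rightarrow> complex" where
  "S_series S p \<phi> = (\<Sum>\<^sub>\<infinity>(m, \<kappa>)\<in>UNIV \<times> (- {0}).
     S m \<kappa> * exp (\<i> * of_int \<kappa> * of_real \<phi>) * p ^ fst m * cnj p ^ snd m)"

definition coeffs_converge ::
  "real \<Rightarrow> (nat \<times> nat \<Rightarrow> complex) \<Rightarrow> (nat \<times> nat \<Rightarrow> int \<Rightarrow> complex) \<Rightarrow> bool" where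
  "coeffs_converge r R S \<longleftrightarrow> (\<forall>\<rho>. 0 \<le> \<rho> \<and> \<rho> < r \<longrightarrow>
     (\<lambda>m. cmod (R m) * \<rho> ^ msize m) summable_on UNIV \<and>
     (\<lambda>(m, \<kappa>). cmod (S m \<kappa>) * \<rho> ^ msize m) summable_on (UNIV \<times> (- {0})))"

text \<open>\<open>P \<epsilon> p \<phi> = R_series R p + \<epsilon> S_series S p \<phi> + o(\<epsilon>)\<close>.\<close>

definition first_order_expansion ::
  "real \<Rightarrow> real \<Rightarrow> (real \<Rightarrow> complex \<Rightarrow> real \<Rightarrow> complex) \<Rightarrow> (nat \<times> nat \<Rightarrow> complex) \<Rightarrow>
   (nat \<times> nat \<Rightarrow> int \<Rightarrow> complex) \<Rightarrow> bool" where
  "first_order_expansion \<epsilon>\<^sub>0 r P R S \<longleftrightarrow> coeffs_converge r R S \<and>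
     (\<forall>p\<in>ball 0 r. \<forall>\<phi>. P 0 p \<phi> = R_series R p \<and>
        ((\<lambda>\<epsilon>. P \<epsilon> p \<phi>) has_vector_derivative S_series S p \<phi>) (at 0 within {0..\<epsilon>\<^sub>0}))"

definition reduced_solution ::
  "(nat \<times> nat \<Rightarrow> complex) \<Rightarrow> (nat \<times> nat \<Rightarrow> int \<Rightarrow> complex) \<Rightarrow> real \<Rightarrow> real \<Rightarrow> real set \<Rightarrow>
   (real \<Rightarrow> complex) \<Rightarrow> (real \<Rightarrow> real) \<Rightarrow> bool" where
  "reduced_solution R S \<epsilon> \<Omega> T p \<phi> \<longleftrightarrow> (\<forall>t\<in>T.
     (p has_vector_derivative (R_series R (p t) + of_real \<epsilon> * S_series S (p t) (\<phi> t)))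
       (at t within T) \<and>
     (\<phi> has_real_derivative \<Omega>) (at t within T))"


section \<open>Polar dynamics\<close>

definition Q :: "real \<Rightarrow> real^2^2" where
  "Q \<alpha> = vector [vector [cos \<alpha>, sin \<alpha>], vector [- sin \<alpha>, cos \<alpha>]]"

definition polar_a :: "(nat \<times> nat \<Rightarrow> complex) \<Rightarrow> real \<Rightarrow> real" where
  "polar_a R \<rho> = Re (\<Sum>\<^sub>\<infinity>m\<in>UNIV. R m * of_real (\<rho> ^ msize m))"

definition polar_b :: "int \<Rightarrow> (nat \<times> nat \<Rightarrow> complex) \<Rightarrow> real \<Rightarrow> real \<Rightarrow> real" where
  "polar_b \<kappa>\<^sub>0 R \<rho> \<Omega> = Im (\<Sum>\<^sub>\<infinity>m\<in>UNIV. R m * of_real (\<rho> ^ msize m)) - of_int \<kappa>\<^sub>0 * \<rho> * \<Omega>"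

definition polar_r ::
  "int \<Rightarrow> (nat \<times> nat \<Rightarrow> complex) \<Rightarrow> (nat \<times> nat \<Rightarrow> int \<Rightarrow> complex) \<Rightarrow> real \<Rightarrow>
   real \<Rightarrow> real \<Rightarrow> real \<Rightarrow> real^2" where
  "polar_r \<kappa>\<^sub>0 R S \<epsilon> \<rho> \<psi> \<Omega> =
     vector [polar_a R \<rho>, polar_b \<kappa>\<^sub>0 R \<rho> \<Omega>] +
     \<epsilon> *\<^sub>R (Q \<psi> *v vector [Re (S (0, 0) \<kappa>\<^sub>0), Im (S (0, 0) \<kappa>\<^sub>0)] +
       (\<Sum>\<^sub>\<infinity>(m, \<kappa>)\<in>(- {(0, 0)}) \<times> (- {0}).
          \<rho> ^ msize m *\<^sub>R (Q (of_int \<kappa> / of_int \<kappa>\<^sub>0 * \<psi>) *v vector [Re (S m \<kappa>), Im (S m \<kappa>)])))"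

text \<open>Curves satisfying \<open>(\<rho>', \<rho> \<psi>') = r(\<rho>, \<psi>, \<Omega>)\<close>.\<close>

definition polar_solution ::
  "int \<Rightarrow> (nat \<times> nat \<Rightarrow> complex) \<Rightarrow> (nat \<times> nat \<Rightarrow> int \<Rightarrow> complex) \<Rightarrow> real \<Rightarrow> real \<Rightarrow>
   real set \<Rightarrow> (real \<Rightarrow> real) \<Rightarrow> (real \<Rightarrow> real) \<Rightarrow> bool" where
  "polar_solution \<kappa>\<^sub>0 R S \<epsilon> \<Omega> T \<rho> \<psi> \<longleftrightarrow> (\<forall>t\<in>T. \<exists>\<rho>' \<psi>'.
     (\<rho> has_real_derivative \<rho>') (at t within T) \<and>
     (\<psi> has_real_derivative \<psi>') (at t within T) \<and>
     vector [\<rho>', \<rho> t * \<psi>'] = polar_r \<kappa>\<^sub>0 R S \<epsilon> (\<rho> t) (\<psi> t) \<Omega>)"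

definition polar_fixed_point ::
  "int \<Rightarrow> (nat \<times> nat \<Rightarrow> complex) \<Rightarrow> (nat \<times> nat \<Rightarrow> int \<Rightarrow> complex) \<Rightarrow> real \<Rightarrow> real \<Rightarrow>
   real \<Rightarrow> real \<Rightarrow> bool" where
  "polar_fixed_point \<kappa>\<^sub>0 R S \<epsilon> \<Omega> \<rho> \<psi> \<longleftrightarrow>
     polar_solution \<kappa>\<^sub>0 R S \<epsilon> \<Omega> UNIV (\<lambda>_. \<rho>) (\<lambda>_. \<psi>)"

text \<open>For \<open>\<rho> > 0\<close> the polar dynamics is \<open>x' = polar_field x\<close> with \<open>x = (\<rho>, \<psi>)\<close>.\<close>

definition polar_field ::
  "int \<Rightarrow> (nat \<times> nat \<Rightarrow> complex) \<Rightarrow> (nat \<times> nat \<Rightarrow> int \<Rightarrow> complex) \<Rightarrow> real \<Rightarrow> real \<Rightarrow>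
   real^2 \<Rightarrow> real^2" where
  "polar_field \<kappa>\<^sub>0 R S \<epsilon> \<Omega> x =
     vector [polar_r \<kappa>\<^sub>0 R S \<epsilon> (x $ 1) (x $ 2) \<Omega> $ 1,
             polar_r \<kappa>\<^sub>0 R S \<epsilon> (x $ 1) (x $ 2) \<Omega> $ 2 / x $ 1]"

definition polar_c ::
  "int \<Rightarrow> (nat \<times> nat \<Rightarrow> int \<Rightarrow> complex) \<Rightarrow> nat \<times> nat \<Rightarrow> int \<Rightarrow> real \<Rightarrow> real" where
  "polar_c \<kappa>\<^sub>0 S m \<kappa> \<psi> =
     Re (S m \<kappa>) * cos (of_int \<kappa> / of_int \<kappa>\<^sub>0 * \<psi>) + Im (S m \<kappa>) * sin (of_int \<kappa> / of_int \<kappa>\<^sub>0 * \<psi>)"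

definition polar_d ::
  "int \<Rightarrow> (nat \<times> nat \<Rightarrow> int \<Rightarrow> complex) \<Rightarrow> nat \<times> nat \<Rightarrow> int \<Rightarrow> real \<Rightarrow> real" where
  "polar_d \<kappa>\<^sub>0 S m \<kappa> \<psi> =
     - Re (S m \<kappa>) * sin (of_int \<kappa> / of_int \<kappa>\<^sub>0 * \<psi>) + Im (S m \<kappa>) * cos (of_int \<kappa> / of_int \<kappa>\<^sub>0 * \<psi>)"

definition polar_J ::
  "int \<Rightarrow> (nat \<times> nat \<Rightarrow> complex) \<Rightarrow> (nat \<times> nat \<Rightarrow> int \<Rightarrow> complex) \<Rightarrow> real \<Rightarrow> real \<Rightarrow>
   real \<Rightarrow> real \<Rightarrow> real^2^2" where
  "polar_J \<kappa>\<^sub>0 R S \<epsilon> \<Omega> \<rho> \<psi> =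
     vector [vector [deriv (polar_a R) \<rho>, 0],
             vector [deriv (\<lambda>s. polar_b \<kappa>\<^sub>0 R s \<Omega> / s) \<rho>, 0]] +
     \<epsilon> *\<^sub>R
      (vector [vector [0, polar_d \<kappa>\<^sub>0 S (0, 0) \<kappa>\<^sub>0 \<psi>],
               vector [- (polar_d \<kappa>\<^sub>0 S (0, 0) \<kappa>\<^sub>0 \<psi> / \<rho>\<^sup>2), - (polar_c \<kappa>\<^sub>0 S (0, 0) \<kappa>\<^sub>0 \<psi> / \<rho>)]] +
       (\<Sum>\<^sub>\<infinity>(m, \<kappa>)\<in>(- {(0, 0)}) \<times> (- {0}).
          vector [vector [polar_c \<kappa>\<^sub>0 S m \<kappa> \<psi> * real (msize m) * \<rho> powi (int (msize m) - 1),
                          of_int \<kappa> / of_int \<kappa>\<^sub>0 * polar_d \<kappa>\<^sub>0 S m \<kappa> \<psi> * \<rho> ^ msize m],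
                  vector [polar_d \<kappa>\<^sub>0 S m \<kappa> \<psi> * (real (msize m) - 1) * \<rho> powi (int (msize m) - 2),
                          - (of_int \<kappa> / of_int \<kappa>\<^sub>0 * polar_c \<kappa>\<^sub>0 S m \<kappa> \<psi>
                             * \<rho> powi (int (msize m) - 1))]]))"


section \<open>Stability\<close>

definition eigenvalues :: "real^'n^'n \<Rightarrow> complex set" where
  "eigenvalues A = {\<mu>. \<exists>v. v \<noteq> 0 \<and> cmat A *v v = \<mu> *s v}"

definition hyperbolic_at :: "(real^'n \<Rightarrow> real^'n) \<Rightarrow> real^'n \<Rightarrow> bool" where
  "hyperbolic_at F x \<longleftrightarrow> F differentiable (at x) \<and>
     (\<forall>\<mu>\<in>eigenvalues (jacobian F (at x)). Re \<mu> \<noteq> 0)"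

text \<open>Below, \<open>sol T x\<close> says that \<open>x\<close> solves the given differential equation on the set of times \<open>T\<close>.
  Stability is required along every solution for as long as it is defined.\<close>

definition lyapunov_stable ::
  "(real set \<Rightarrow> (real \<Rightarrow> 'a::metric_space) \<Rightarrow> bool) \<Rightarrow> 'a \<Rightarrow> bool" where
  "lyapunov_stable sol x\<^sub>0 \<longleftrightarrow> (\<forall>e>0. \<exists>d>0. \<forall>\<tau>>0. \<forall>x.
     sol {0..<\<tau>} x \<and> dist (x 0) x\<^sub>0 < d \<longrightarrow> (\<forall>t\<in>{0..<\<tau>}. dist (x t) x\<^sub>0 < e))"

definition asymptotically_stable ::
  "(real set \<Rightarrow> (real \<Rightarrow> 'a::metric_space) \<Rightarrow> bool) \<Rightarrow> 'a \<Rightarrow> bool" where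
  "asymptotically_stable sol x\<^sub>0 \<longleftrightarrow> lyapunov_stable sol x\<^sub>0 \<and>
     (\<exists>d>0. \<forall>x. sol {0..} x \<and> dist (x 0) x\<^sub>0 < d \<longrightarrow> (x \<longlongrightarrow> x\<^sub>0) at_top)"

text \<open>Polar solutions in the region \<open>0 < \<rho> < r\<close> where the polar coordinates and the reduced dynamics
  are defined.\<close>

definition polar_state_solution ::
  "real \<Rightarrow> int \<Rightarrow> (nat \<times> nat \<Rightarrow> complex) \<Rightarrow> (nat \<times> nat \<Rightarrow> int \<Rightarrow> complex) \<Rightarrow> real \<Rightarrow> real \<Rightarrow>
   real set \<Rightarrow> (real \<Rightarrow> real^2) \<Rightarrow> bool" where
  "polar_state_solution r \<kappa>\<^sub>0 R S \<epsilon> \<Omega> T x \<longleftrightarrow>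
     (\<forall>t\<in>T. 0 < x t $ 1 \<and> x t $ 1 < r) \<and>
     polar_solution \<kappa>\<^sub>0 R S \<epsilon> \<Omega> T (\<lambda>t. x t $ 1) (\<lambda>t. x t $ 2)"

end

theory Submission
  imports Defs
begin

text \<open>
  The core of the argument is that the near-resonances of the normal form are exact relations between
  indices. The external resonance places \<open>Im lam\<close> within \<open>\<delta>\<close> of \<open>\<kappa>\<^sub>0 \<Omega>\<close>, and the tolerances are small
  against the spacing \<open>\<Omega>\<close> of the harmonics. Comparing frequencies, a nonzero \<open>R m\<close> has
  \<open>m\<^sub>1 = m\<^sub>2 + 1\<close> (\<open>autonomous_resonance_exact\<close>) and a nonzero \<open>S m \<kappa>\<close> has \<open>\<kappa> = \<kappa>\<^sub>0 (1 - m\<^sub>1 + m\<^sub>2)\<close>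
  (\<open>forced_resonance_exact\<close>). Hence in \<open>p = \<rho> exp (i \<theta>)\<close> every monomial of \<open>p' exp (- i \<theta>)\<close> depends on
  \<open>\<theta>\<close> and \<open>\<phi>\<close> only through \<open>\<psi> = \<theta> - \<kappa>\<^sub>0 \<phi>\<close> (\<open>reduced_dynamics_rotated\<close>), and real and imaginary parts
  are the polar equations (\<open>reduced_iff_polar_solution\<close>). A constant curve has zero velocity, so
  fixed points are the zeros of \<open>r\<close>.

  The Jacobian is obtained by termwise differentiation (\<open>has_derivative_infsum\<close>). Differentiation in
  \<open>\<psi>\<close> brings down the factor \<open>\<kappa> / \<kappa>\<^sub>0\<close>; the index relation bounds it by \<open>|m| + 1\<close>, so the derivatives
  converge on the same domain as the series itself, and locally uniformly (\<open>mode_series\<close>).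

  For stability, a hyperbolic matrix of size two is a sink, a source or a saddle according to the
  signs of its trace and determinant. In each case an explicit quadratic form is strictly monotone along
  the linear flow, and by differentiability along the nonlinear flow near the fixed point. In the sink
  case this is Lyapunov's direct method (\<open>linearized_sink_asymptotically_stable\<close>). In the other cases a
  solution that starts where the form is positive must leave a small ball
  (\<open>linearized_growth_not_stable\<close>); that such a solution exists for long enough follows from the
  Lipschitz bound on the field by a global Picard iteration (\<open>ode_global_solution\<close>). Since
  hyperbolicity excludes every other sign pattern, the two implications become the stated equivalences.
\<close>

section \<open>Global solutions of Lipschitz differential equations\<close>

text \<open>Picard iteration on the whole half-line at once: in the sup norm weighted by \<open>exp (- 2 k t)\<close> the
integral operator of a \<open>k\<close>-Lipschitz field is a contraction with constant \<open>1/2\<close>, so one fixed point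
gives the global solution and no continuation of local solutions is involved. Boundedness of the
field keeps the weighted iterates bounded.\<close>

lemma ode_global_solution:
  fixes F :: "'a::euclidean_space \<Rightarrow> 'a" and a :: 'a
  assumes lip: "L-lipschitz_on UNIV F" and bnd: "\<And>x. norm (F x) \<le> B"
  obtains x where "x 0 = a"
    "\<And>t. t \<ge> 0 \<Longrightarrow> (x has_vector_derivative F (x t)) (at t within {0..})"
proof -
  define k where "k = L + 1"
  have k: "k > 0" and lip_k: "dist (F x) (F y) \<le> k * dist x y" for x y
  proof -
    have "L \<ge> 0" using lip by (rule lipschitz_on_nonneg)
    thus "k > 0" by (simp add: k_def)
    show "dist (F x) (F y) \<le> k * dist x y"
      using lipschitz_onD[OF lip, of x y] by (simp add: k_def algebra_simps add_increasing)
  qed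
  have B: "B \<ge> 0" using bnd[of 0] norm_ge_zero order_trans by blast
  have contF: "continuous_on UNIV F" using lip by (rule lipschitz_on_continuous_on)
  \<comment> \<open>An unknown \<open>y\<close> encodes the curve \<open>a + exp (2 k t) y t\<close>; \<open>max 0 t\<close> extends the operator
      constantly to negative times, so that it acts on functions on the real line.\<close>
  define v where "v y s = F (a + exp (2 * k * s) *\<^sub>R apply_bcontfun y s)" for y :: "real \<Rightarrow>\<^sub>C 'a" and s
  define I where "I y t = integral {0..t} (v y)" for y t
  define G where "G y t = exp (- (2 * k * max 0 t)) *\<^sub>R I y (max 0 t)" for y t
  have contv: "continuous_on X (v y)" for X y
    unfolding v_def
    by (rule continuous_on_compose2[OF contF]) (auto intro!: continuous_intros)
  have dI: "(I y has_vector_derivative v y t) (at t within {0..})" if "t \<ge> 0" for y t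
  proof -
    have "(I y has_vector_derivative v y t) (at t within {0..t+1})"
      unfolding I_def using that by (intro integral_has_vector_derivative contv) auto
    moreover have "at t within {0..t+1} = at t within {0..}"
      by (rule at_within_nhd[of t "{..<t+1}"]) auto
    ultimately show ?thesis by simp
  qed
  have contI: "continuous_on {0..} (I y)" for y
    using dI by (intro continuous_on_vector_derivative) auto
  have contG: "continuous_on UNIV (G y)" for y
    unfolding G_def
    by (intro continuous_intros continuous_on_compose2[OF contI]) auto
  have normI: "norm (I y t) \<le> B * t" if "t \<ge> 0" for y t
  proof -
    have "norm (I y t) \<le> integral {0..t} (\<lambda>_. B)"
      unfolding I_def
      by (rule integral_norm_bound_integral)
         (auto intro!: integrable_continuous_real contv simp: v_def bnd)
    thus ?thesis using that by (simp add: mult.commute)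
  qed
  have bndG: "norm (G y t) \<le> B / (2 * k)" for y t
  proof -
    define u where "u = max 0 t"
    have u: "u \<ge> 0" by (simp add: u_def)
    \<comment> \<open>The weight beats the linear growth of the integral of a bounded field.\<close>
    have "2 * k * u \<le> exp (2 * k * u)"
      using exp_ge_add_one_self[of "2 * k * u"] by linarith
    hence *: "exp (- (2 * k * u)) * u \<le> 1 / (2 * k)"
      using k by (simp add: exp_minus field_simps)
    have "norm (G y t) \<le> exp (- (2 * k * u)) * (B * u)"
      using normI[OF u] by (simp add: G_def u_def[symmetric])
    also have "\<dots> = B * (exp (- (2 * k * u)) * u)" by simp
    also have "\<dots> \<le> B * (1 / (2 * k))" by (rule mult_left_mono[OF * B])
    finally show ?thesis by simp
  qed
  have memG: "G y \<in> bcontfun" for y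
    using contG bndG by (auto simp: bcontfun_def bounded_iff)
  define \<Gamma> where "\<Gamma> y = Bcontfun (G y)" for y
  have \<Gamma>: "apply_bcontfun (\<Gamma> y) = G y" for y
    unfolding \<Gamma>_def using memG by (rule Bcontfun_inverse)
  have "dist (\<Gamma> y) (\<Gamma> z) \<le> 1/2 * dist y z" for y z
  proof (rule dist_bound, unfold \<Gamma>)
    fix t :: real
    define u where "u = max 0 t"
    have u: "u \<ge> 0" by (simp add: u_def)
    define D where "D = dist y z"
    have D: "D \<ge> 0" by (simp add: D_def)
    have *: "((\<lambda>s. k * D * exp (2 * k * s)) has_integral
        D / 2 * exp (2 * k * u) - D / 2 * exp (2 * k * 0)) {0..u}"
      using u by (intro fundamental_theorem_of_calculus)
        (auto intro!: derivative_eq_intros simp flip: has_real_derivative_iff_has_vector_derivative)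
    have "norm (v y s - v z s) \<le> k * D * exp (2 * k * s)" for s
    proof -
      have "norm (v y s - v z s) \<le> k * dist (a + exp (2 * k * s) *\<^sub>R y s) (a + exp (2 * k * s) *\<^sub>R z s)"
        unfolding v_def dist_norm[symmetric] by (rule lip_k)
      also have "\<dots> = k * (exp (2 * k * s) * dist (y s) (z s))"
        by (simp add: dist_norm flip: scaleR_diff_right)
      also have "\<dots> \<le> k * (exp (2 * k * s) * D)"
        using k dist_bounded[of y s z] by (intro mult_left_mono) (auto simp: D_def)
      finally show ?thesis by (simp add: mult_ac)
    qed
    hence "norm (integral {0..u} (\<lambda>s. v y s - v z s)) \<le> integral {0..u} (\<lambda>s. k * D * exp (2 * k * s))"
      using * by (intro integral_norm_bound_integral)
        (auto intro!: integrable_continuous_real continuous_intros contv)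
    also have "\<dots> = D / 2 * exp (2 * k * u) - D / 2"
      using integral_unique[OF *] by simp
    also have "\<dots> \<le> D / 2 * exp (2 * k * u)" using D by simp
    finally have "norm (I y u - I z u) \<le> D / 2 * exp (2 * k * u)"
      unfolding I_def by (subst (asm) Henstock_Kurzweil_Integration.integral_diff)
        (auto intro!: integrable_continuous_real contv)
    hence "exp (- (2 * k * u)) * norm (I y u - I z u) \<le> exp (- (2 * k * u)) * (D / 2 * exp (2 * k * u))"
      by (intro mult_left_mono) auto
    also have "\<dots> = D / 2" by (simp add: exp_minus field_simps)
    finally show "dist (G y t) (G z t) \<le> 1 / 2 * dist y z"
      by (simp add: G_def dist_norm D_def flip: scaleR_diff_right u_def)
  qed
  then obtain y where y: "\<Gamma> y = y"
    using banach_fix_type[of "1/2" \<Gamma>] by auto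
  define x where "x t = a + I y t" for t
  have "a + exp (2 * k * t) *\<^sub>R y t = x t" if "t \<ge> 0" for t
  proof -
    have "y t = exp (- (2 * k * t)) *\<^sub>R I y t"
      using \<Gamma>[of y] that by (simp add: y G_def max_def)
    thus ?thesis by (simp add: x_def flip: exp_add)
  qed
  hence "v y t = F (x t)" if "t \<ge> 0" for t
    using that by (simp add: v_def)
  hence "(x has_vector_derivative F (x t)) (at t within {0..})" if "t \<ge> 0" for t
    using dI[OF that, of y] that unfolding x_def
    by (auto intro!: derivative_eq_intros)
  moreover have "x 0 = a" by (simp add: x_def I_def)
  ultimately show ?thesis using that by blast
qed

section \<open>Linearized stability and instability\<close>

lemma first_crossing:
  fixes g :: "real \<Rightarrow> real"
  assumes "continuous_on {0..t} g" "0 \<le> t" "g 0 < s" "s \<le> g t"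
  obtains u where "0 < u" "u \<le> t" "g u = s" "\<And>w. 0 \<le> w \<Longrightarrow> w < u \<Longrightarrow> g w < s"
proof -
  define Z where "Z = {0..t} \<inter> g -` {s..}"
  have "closed Z" unfolding Z_def
    using assms(1) by (intro continuous_closed_preimage) auto
  hence "compact Z" by (metis Z_def bounded_Int bounded_closed_interval compact_eq_bounded_closed)
  moreover have "Z \<noteq> {}" using assms by (auto simp: Z_def)
  ultimately obtain u where u: "u \<in> Z" "\<And>w. w \<in> Z \<Longrightarrow> u \<le> w"
    using compact_attains_inf by metis
  have before: "g w < s" if "0 \<le> w" "w < u" for w
  proof (rule ccontr)
    assume "\<not> g w < s"
    hence "w \<in> Z" using that u(1) by (auto simp: Z_def)
    thus False using u(2)[of w] that by simp
  qed
  have "continuous_on {0..u} g"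
    using u(1) by (intro continuous_on_subset[OF assms(1)]) (auto simp: Z_def)
  then obtain w where w: "0 \<le> w" "w \<le> u" "g w = s"
    using IVT'[of g 0 s u] u(1) assms(3) by (auto simp: Z_def)
  have "w = u" using before[of w] w by (cases "w = u") auto
  moreover have "u \<noteq> 0" using u(1) assms(3) by (auto simp: Z_def)
  ultimately show ?thesis using that[of u] u(1) w before by (auto simp: Z_def)
qed

lemma quadratic_form_derivative:
  fixes x :: "real \<Rightarrow> 'a::real_inner"
  assumes P: "bounded_linear P" and sym: "\<And>y z. P y \<bullet> z = y \<bullet> P z"
    and x: "(x has_vector_derivative x') (at t within T)"
  shows "((\<lambda>t. (x t - x\<^sub>0) \<bullet> P (x t - x\<^sub>0)) has_real_derivative 2 * (P (x t - x\<^sub>0) \<bullet> x'))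
           (at t within T)"
proof -
  have y: "((\<lambda>t. x t - x\<^sub>0) has_vector_derivative x') (at t within T)"
    using has_vector_derivative_diff[OF x has_vector_derivative_const, of x\<^sub>0] by simp
  have "((\<lambda>t. P (x t - x\<^sub>0)) has_vector_derivative P x') (at t within T)"
    by (rule bounded_linear.has_vector_derivative[OF P y])
  from bounded_bilinear.has_vector_derivative[OF bounded_bilinear_inner y this]
  show ?thesis
    by (simp add: has_real_derivative_iff_has_vector_derivative sym[of _ x'] inner_commute[of x'])
qed

text \<open>The linearization error is \<open>o(|x - x\<^sub>0|)\<close> and \<open>P\<close> is bounded, so their product is below any multiple
of \<open>|x - x\<^sub>0|\<^sup>2\<close>. A strict sign of \<open>P y \<bullet> A y\<close> therefore survives the passage from the linear to the
nonlinear field, at half strength.\<close>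

lemma quadratic_form_near_linearization:
  fixes F :: "'a::real_inner \<Rightarrow> 'a"
  assumes F: "(F has_derivative A) (at x\<^sub>0)" "F x\<^sub>0 = 0" and P: "bounded_linear P" and c: "c > 0"
  obtains e where "e > 0"
    "\<And>x. dist x x\<^sub>0 < e \<Longrightarrow>
       2 * \<bar>P (x - x\<^sub>0) \<bullet> F x - P (x - x\<^sub>0) \<bullet> A (x - x\<^sub>0)\<bar> \<le> c * ((x - x\<^sub>0) \<bullet> (x - x\<^sub>0))"
proof -
  obtain K where K: "K > 0" "\<And>y. norm (P y) \<le> norm y * K"
    using bounded_linear.pos_bounded[OF P] by blast
  have "c / (2 * K) > 0" using c K by simp
  then obtain e where e: "e > 0"
    "\<And>x. norm (x - x\<^sub>0) < e \<Longrightarrow> norm (F x - F x\<^sub>0 - A (x - x\<^sub>0)) \<le> c / (2 * K) * norm (x - x\<^sub>0)"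
    using F(1) unfolding has_derivative_at_alt by blast
  show ?thesis
  proof (rule that[OF e(1)])
    fix x assume x: "dist x x\<^sub>0 < e"
    define y where "y = x - x\<^sub>0"
    have "\<bar>P y \<bullet> F x - P y \<bullet> A y\<bar> = \<bar>P y \<bullet> (F x - A y)\<bar>" by (simp add: inner_diff_right)
    also have "\<dots> \<le> norm (P y) * norm (F x - A y)" by (rule Cauchy_Schwarz_ineq2)
    also have "\<dots> \<le> (norm y * K) * (c / (2 * K) * norm y)"
      using K e(2)[of x] x F(2) by (intro mult_mono) (auto simp: y_def dist_norm)
    also have "\<dots> = c / 2 * (y \<bullet> y)" using K(1) by (simp add: dot_square_norm power2_eq_square)
    finally show "2 * \<bar>P (x - x\<^sub>0) \<bullet> F x - P (x - x\<^sub>0) \<bullet> A (x - x\<^sub>0)\<bar> \<le> c * ((x - x\<^sub>0) \<bullet> (x - x\<^sub>0))"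
      by (simp add: y_def)
  qed
qed

lemma quadratic_form_upper_bound:
  fixes P :: "'a::real_inner \<Rightarrow> 'a"
  assumes "bounded_linear P"
  obtains \<beta> where "\<beta> > 0" "\<And>y. y \<bullet> P y \<le> \<beta> * (y \<bullet> y)"
proof -
  obtain K where K: "K > 0" "\<And>y. norm (P y) \<le> norm y * K"
    using bounded_linear.pos_bounded[OF assms] by blast
  have "y \<bullet> P y \<le> K * (y \<bullet> y)" for y
  proof -
    have "y \<bullet> P y \<le> norm y * norm (P y)" by (rule norm_cauchy_schwarz)
    also have "\<dots> \<le> norm y * (norm y * K)" by (intro mult_left_mono K) auto
    finally show ?thesis by (simp add: dot_square_norm power2_eq_square mult_ac)
  qed
  thus ?thesis using that K(1) by blast
qed

text \<open>Lyapunov's direct method with \<open>V x = (x - x\<^sub>0) \<bullet> P (x - x\<^sub>0)\<close>. Near \<open>x\<^sub>0\<close> the derivative of \<open>V\<close> along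
solutions is at most \<open>- c |x - x\<^sub>0|\<^sup>2\<close>, which first traps solutions in small balls and then makes
\<open>V\<close> decay exponentially. Only given solutions are estimated, so differentiability of
the field at \<open>x\<^sub>0\<close> suffices.\<close>

lemma linearized_sink_asymptotically_stable:
  fixes F A P :: "'a::real_inner \<Rightarrow> 'a"
  assumes F: "(F has_derivative A) (at x\<^sub>0)" "F x\<^sub>0 = 0"
    and P: "bounded_linear P" and sym: "\<And>y z. P y \<bullet> z = y \<bullet> P z"
    and pos: "\<alpha> > 0" "\<And>y. \<alpha> * (y \<bullet> y) \<le> y \<bullet> P y"
    and decay: "c > 0" "\<And>y. P y \<bullet> A y \<le> - (c * (y \<bullet> y))"
    and sol: "\<And>T x t. sol T x \<Longrightarrow> t \<in> T \<Longrightarrow> (x has_vector_derivative F (x t)) (at t within T)"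
  shows "asymptotically_stable sol x\<^sub>0"
proof -
  obtain \<beta> where \<beta>: "\<beta> > 0" "\<And>y. y \<bullet> P y \<le> \<beta> * (y \<bullet> y)"
    using quadratic_form_upper_bound[OF P] by blast
  obtain e where e: "e > 0" "\<And>x. dist x x\<^sub>0 < e \<Longrightarrow>
       2 * \<bar>P (x - x\<^sub>0) \<bullet> F x - P (x - x\<^sub>0) \<bullet> A (x - x\<^sub>0)\<bar> \<le> c * ((x - x\<^sub>0) \<bullet> (x - x\<^sub>0))"
    using quadratic_form_near_linearization[OF F P decay(1)] by blast
  define V where "V x = (x - x\<^sub>0) \<bullet> P (x - x\<^sub>0)" for x
  define V' where "V' x = 2 * (P (x - x\<^sub>0) \<bullet> F x)" for x
  have V': "V' x \<le> - (c * ((x - x\<^sub>0) \<bullet> (x - x\<^sub>0)))" if "dist x x\<^sub>0 < e" for x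
    using e(2)[OF that] decay(2)[of "x - x\<^sub>0"] unfolding V'_def by (smt (verit))
  have dist2: "(x - x\<^sub>0) \<bullet> (x - x\<^sub>0) = (dist x x\<^sub>0)\<^sup>2" for x
    by (simp add: dist_norm dot_square_norm)
  have Vlow: "\<alpha> * (dist x x\<^sub>0)\<^sup>2 \<le> V x" and Vup: "V x \<le> \<beta> * (dist x x\<^sub>0)\<^sup>2" for x
    using pos(2)[of "x - x\<^sub>0"] \<beta>(2)[of "x - x\<^sub>0"] by (simp_all add: V_def dist2)
  have dV: "((\<lambda>t. V (x t)) has_real_derivative V' (x t)) (at t within T)"
    if "(x has_vector_derivative F (x t)) (at t within T)" for x t T
    unfolding V_def V'_def by (rule quadratic_form_derivative[OF P sym that])

  \<comment> \<open>If a trajectory reached distance \<open>s\<close>, then \<open>V\<close> would not have increased up to the first such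
      time, contradicting \<open>V (x 0) < \<alpha> s\<^sup>2\<close>.\<close>
  have trap: "dist (x t) x\<^sub>0 < s"
    if T: "\<And>t. t \<in> T \<Longrightarrow> (x has_vector_derivative F (x t)) (at t within T)"
      "t \<in> T" "0 \<le> t" "{0..t} \<subseteq> T"
      and s: "0 < s" "s < e" "\<beta> * (dist (x 0) x\<^sub>0)\<^sup>2 < \<alpha> * s\<^sup>2" "dist (x 0) x\<^sub>0 < s" for T x t s
  proof (rule ccontr)
    assume "\<not> ?thesis"
    hence far: "s \<le> dist (x t) x\<^sub>0" by simp
    have d: "(x has_vector_derivative F (x w)) (at w within {0..t})" if "w \<in> {0..t}" for w
      using T(1)[of w] T(4) that has_vector_derivative_within_subset by blast
    hence "continuous_on {0..t} x" by (rule continuous_on_vector_derivative)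
    hence "continuous_on {0..t} (\<lambda>w. dist (x w) x\<^sub>0)" by (intro continuous_intros)
    then obtain u where u: "0 < u" "u \<le> t" "dist (x u) x\<^sub>0 = s"
      "\<And>w. 0 \<le> w \<Longrightarrow> w < u \<Longrightarrow> dist (x w) x\<^sub>0 < s"
      using first_crossing[OF _ T(3) s(4) far] by metis
    have dVu: "((\<lambda>w. V (x w)) has_derivative (\<lambda>h. V' (x w) * h)) (at w within {0..u})"
      if "0 \<le> w" "w \<le> u" for w
    proof -
      have "(x has_vector_derivative F (x w)) (at w within {0..u})"
        by (rule has_vector_derivative_within_subset[OF d]) (use that u in auto)
      thus ?thesis using dV by (simp add: has_field_derivative_def)
    qed
    obtain w where w: "w \<in> {0<..<u}" "V (x u) - V (x 0) = V' (x w) * (u - 0)"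
      using mvt_simple[OF u(1) dVu] by auto
    have "V' (x w) \<le> 0"
      using V'[of "x w"] u(4)[of w] w(1) s(2) decay(1)
      by (smt (verit) greaterThanLessThan_iff inner_ge_zero mult_nonneg_nonneg mult_minus_left)
    hence "V (x u) \<le> V (x 0)" using w u(1) by (smt (verit) mult_nonpos_nonneg)
    thus False using Vlow[of "x u"] Vup[of "x 0"] s(3) u(3) by simp
  qed

  \<comment> \<open>\<open>V\<close> lies between \<open>\<alpha>\<close> and \<open>\<beta>\<close> times the squared distance, so shrinking the radius by
      \<open>sqrt (\<alpha> / \<beta>)\<close> is enough.\<close>
  have radius: "\<exists>d>0. d \<le> s \<and> (\<forall>q. 0 \<le> q \<and> q < d \<longrightarrow> \<beta> * q\<^sup>2 < \<alpha> * s\<^sup>2)" if "s > 0" for s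
  proof (intro exI conjI allI impI)
    define d where "d = min s (s * sqrt (\<alpha> / \<beta>))"
    show "d > 0" "d \<le> s" using that pos \<beta> by (auto simp: d_def)
    fix q assume q: "0 \<le> q \<and> q < d"
    have "q < s * sqrt (\<alpha> / \<beta>)" using q by (simp add: d_def)
    hence "q\<^sup>2 < (s * sqrt (\<alpha> / \<beta>))\<^sup>2" using q by (intro power_strict_mono) auto
    also have "\<dots> = s\<^sup>2 * (\<alpha> / \<beta>)" using pos(1) \<beta>(1) by (simp add: power_mult_distrib)
    finally show "\<beta> * q\<^sup>2 < \<alpha> * s\<^sup>2" using \<beta>(1) by (simp add: field_simps)
  qed

  have "lyapunov_stable sol x\<^sub>0"
    unfolding lyapunov_stable_def
  proof (intro allI impI)
    fix e' :: real assume "e' > 0"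
    define s where "s = min e' (e / 2)"
    have s: "s > 0" "s < e" "s \<le> e'" using \<open>e' > 0\<close> e(1) by (auto simp: s_def)
    obtain d where d: "d > 0" "d \<le> s" "\<And>q. 0 \<le> q \<Longrightarrow> q < d \<Longrightarrow> \<beta> * q\<^sup>2 < \<alpha> * s\<^sup>2"
      using radius[OF s(1)] by blast
    have "dist (x t) x\<^sub>0 < e'"
      if "sol {0..<\<tau>} x" "dist (x 0) x\<^sub>0 < d" "t \<in> {0..<\<tau>}" for \<tau> x t
    proof -
      have "dist (x t) x\<^sub>0 < s"
        by (rule trap[OF sol[OF that(1)] that(3)]) (use that(2,3) s(1,2) d in auto)
      thus ?thesis using s(3) by simp
    qed
    thus "\<exists>d>0. \<forall>\<tau>>0. \<forall>x. sol {0..<\<tau>} x \<and> dist (x 0) x\<^sub>0 < d \<longrightarrow>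
            (\<forall>t\<in>{0..<\<tau>}. dist (x t) x\<^sub>0 < e')"
      using d(1) by blast
  qed
  moreover
  define s where "s = e / 2"
  have s: "s > 0" "s < e" using e(1) by (auto simp: s_def)
  obtain d where d: "d > 0" "d \<le> s" "\<And>q. 0 \<le> q \<Longrightarrow> q < d \<Longrightarrow> \<beta> * q\<^sup>2 < \<alpha> * s\<^sup>2"
    using radius[OF s(1)] by blast
  have "(x \<longlongrightarrow> x\<^sub>0) at_top" if x: "sol {0..} x" "dist (x 0) x\<^sub>0 < d" for x
  proof -
    have near: "dist (x t) x\<^sub>0 < e" if "t \<ge> 0" for t
    proof -
      have "dist (x t) x\<^sub>0 < s"
        by (rule trap[OF sol[OF x(1)]]) (use x(2) that s d in auto)
      thus ?thesis using s(2) by simp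
    qed
    define k where "k = c / \<beta>"
    have k: "k > 0" using decay(1) \<beta>(1) by (simp add: k_def)
    have decay_V: "V' (x t) \<le> - k * V (x t)" if "t \<ge> 0" for t
    proof -
      have "k * V (x t) \<le> k * (\<beta> * (dist (x t) x\<^sub>0)\<^sup>2)"
        using k by (intro mult_left_mono Vup) auto
      also have "\<dots> = c * (dist (x t) x\<^sub>0)\<^sup>2" using \<beta>(1) by (simp add: k_def)
      finally show ?thesis using V'[OF near[OF that]] by (simp add: dist2)
    qed
    \<comment> \<open>Gronwall's inequality: \<open>exp (k t) V\<close> has nonpositive derivative.\<close>
    have mono: "exp (k * t) * V (x t) \<le> V (x 0)" if t: "t > 0" for t
    proof -
      have "((\<lambda>w. exp (k * w) * V (x w)) has_derivative
          (\<lambda>h. (exp (k * w) * (k * V (x w) + V' (x w))) * h)) (at w within {0..t})"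
        if "0 \<le> w" "w \<le> t" for w
      proof -
        have "(x has_vector_derivative F (x w)) (at w within {0..t})"
          by (rule has_vector_derivative_within_subset[OF sol[OF x(1)]]) (use that in auto)
        from dV[OF this]
        have "((\<lambda>w. exp (k * w) * V (x w)) has_real_derivative
          exp (k * w) * (k * V (x w) + V' (x w))) (at w within {0..t})"
          by (auto intro!: derivative_eq_intros simp: algebra_simps)
        thus ?thesis by (simp add: has_field_derivative_def)
      qed
      from mvt_simple[OF t this] obtain w where w: "w \<in> {0<..<t}"
        "exp (k * t) * V (x t) - V (x 0) = exp (k * w) * (k * V (x w) + V' (x w)) * t"
        by auto
      have "exp (k * w) * (k * V (x w) + V' (x w)) * t \<le> 0"
        using decay_V[of w] w(1) t by (simp add: mult_nonpos_nonneg mult_nonneg_nonpos)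
      thus ?thesis using w(2) by simp
    qed
    have bound: "(dist (x t) x\<^sub>0)\<^sup>2 \<le> V (x 0) / \<alpha> * exp (- (k * t))" if t: "t > 0" for t
    proof -
      have "\<alpha> * (dist (x t) x\<^sub>0)\<^sup>2 \<le> V (x t)" by (rule Vlow)
      also have "\<dots> \<le> V (x 0) * exp (- (k * t))"
        using mono[OF t]
        by (simp add: exp_minus pos_le_divide_eq mult.commute flip: divide_inverse)
      finally show ?thesis using pos(1) by (simp add: pos_le_divide_eq mult.commute)
    qed
    have "((\<lambda>t. V (x 0) / \<alpha> * exp (- (k * t))) \<longlongrightarrow> V (x 0) / \<alpha> * 0) at_top"
      using k by (intro tendsto_intros filterlim_compose[OF exp_at_bot] 
          filterlim_uminus_at_bot_at_top[THEN filterlim_compose]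
          filterlim_tendsto_pos_mult_at_top[OF tendsto_const] filterlim_ident)
    hence lim: "((\<lambda>t. V (x 0) / \<alpha> * exp (- (k * t))) \<longlongrightarrow> 0) at_top"
      by (simp only: mult_zero_right)
    have "\<forall>\<^sub>F t in at_top. norm ((dist (x t) x\<^sub>0)\<^sup>2) \<le> V (x 0) / \<alpha> * exp (- (k * t))"
      by (rule eventually_mono[OF eventually_gt_at_top[of 0]])
         (use bound in \<open>simp only: real_norm_def abs_power2\<close>)
    from Lim_null_comparison[OF this lim]
    have "((\<lambda>t. (dist (x t) x\<^sub>0)\<^sup>2) \<longlongrightarrow> 0) at_top" .
    from tendsto_real_sqrt[OF this] have "((\<lambda>t. dist (x t) x\<^sub>0) \<longlongrightarrow> 0) at_top" by simp
    thus ?thesis by (simp add: tendsto_dist_iff[of x])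
  qed
  ultimately show ?thesis
    unfolding asymptotically_stable_def using d(1) by blast
qed

text \<open>Chetaev's instability argument. Along the nonlinear flow \<open>V x = (x - x\<^sub>0) \<bullet> P (x - x\<^sub>0)\<close> grows at rate
at least \<open>c |x - x\<^sub>0|\<^sup>2\<close>, so a solution starting where \<open>V > 0\<close> stays away from \<open>x\<^sub>0\<close>; then \<open>V\<close> grows
at a definite rate and the solution cannot remain in a small ball. Refuting stability needs such a
solution to exist for long enough; it is obtained by composing the field with the projection onto a
ball, which makes it globally Lipschitz and bounded.\<close>

lemma linearized_growth_not_stable:
  fixes F A P :: "'a::euclidean_space \<Rightarrow> 'a"
  assumes F: "(F has_derivative A) (at x\<^sub>0)" "F x\<^sub>0 = 0"
    and lip: "0 < s" "L-lipschitz_on (cball x\<^sub>0 s) F"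
    and P: "bounded_linear P" and sym: "\<And>y z. P y \<bullet> z = y \<bullet> P z"
    and pos: "w \<bullet> P w > 0"
    and growth: "c > 0" "\<And>y. c * (y \<bullet> y) \<le> P y \<bullet> A y"
    and sol: "\<And>\<tau> x. (\<And>t. t \<in> {0..<\<tau>} \<Longrightarrow> x t \<in> cball x\<^sub>0 s \<and>
        (x has_vector_derivative F (x t)) (at t within {0..<\<tau>})) \<Longrightarrow> sol {0..<\<tau>} x"
  shows "\<not> lyapunov_stable sol x\<^sub>0"
proof
  assume stable: "lyapunov_stable sol x\<^sub>0"
  obtain \<beta> where \<beta>: "\<beta> > 0" "\<And>y. y \<bullet> P y \<le> \<beta> * (y \<bullet> y)"
    using quadratic_form_upper_bound[OF P] by blast
  obtain e\<^sub>0 where e\<^sub>0: "e\<^sub>0 > 0" "\<And>x. dist x x\<^sub>0 < e\<^sub>0 \<Longrightarrow>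
       2 * \<bar>P (x - x\<^sub>0) \<bullet> F x - P (x - x\<^sub>0) \<bullet> A (x - x\<^sub>0)\<bar> \<le> c * ((x - x\<^sub>0) \<bullet> (x - x\<^sub>0))"
    using quadratic_form_near_linearization[OF F P growth(1)] by blast
  define e where "e = min e\<^sub>0 s"
  have e: "e > 0" "e \<le> e\<^sub>0" "e \<le> s" using e\<^sub>0(1) lip(1) by (auto simp: e_def)
  define V where "V x = (x - x\<^sub>0) \<bullet> P (x - x\<^sub>0)" for x
  define V' where "V' x = 2 * (P (x - x\<^sub>0) \<bullet> F x)" for x
  have V': "c * ((x - x\<^sub>0) \<bullet> (x - x\<^sub>0)) \<le> V' x" if "dist x x\<^sub>0 < e" for x
    using e\<^sub>0(2)[of x] that e growth(2)[of "x - x\<^sub>0"] unfolding V'_def by (smt (verit))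
  have dist2: "(x - x\<^sub>0) \<bullet> (x - x\<^sub>0) = (dist x x\<^sub>0)\<^sup>2" for x
    by (simp add: dist_norm dot_square_norm)
  have Vup: "V x \<le> \<beta> * (dist x x\<^sub>0)\<^sup>2" for x
    using \<beta>(2)[of "x - x\<^sub>0"] by (simp_all add: V_def dist2)

  have "e / 2 > 0" using e by simp
  then obtain d where d: "d > 0" "\<And>\<tau> x t. \<tau> > 0 \<Longrightarrow> sol {0..<\<tau>} x \<Longrightarrow> dist (x 0) x\<^sub>0 < d \<Longrightarrow>
      t \<in> {0..<\<tau>} \<Longrightarrow> dist (x t) x\<^sub>0 < e / 2"
    using stable unfolding lyapunov_stable_def by metis
  have "w \<noteq> 0" using pos by auto
  \<comment> \<open>A start on the ray through \<open>w\<close>, inside the stability radius \<open>d\<close>.\<close>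
  define l where "l = min d (e / 2) / (2 * norm w)"
  have l: "l > 0" "l * norm w < d" "l * norm w < e / 2"
    using \<open>w \<noteq> 0\<close> d(1) e(1) by (auto simp: l_def min_def field_simps)

  \<comment> \<open>Globally Lipschitz and bounded, and equal to \<open>F\<close> inside the ball.\<close>
  define H where "H x = F (closest_point (cball x\<^sub>0 s) x)" for x
  have cp: "closest_point (cball x\<^sub>0 s) x \<in> cball x\<^sub>0 s" for x
    using lip(1) by (intro closest_point_in_set) auto
  have L: "L \<ge> 0" using lip(2) by (rule lipschitz_on_nonneg)
  have "L-lipschitz_on UNIV H"
  proof (rule lipschitz_onI[OF _ L])
    fix x y
    have "dist (H x) (H y) \<le> L * dist (closest_point (cball x\<^sub>0 s) x) (closest_point (cball x\<^sub>0 s) y)"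
      unfolding H_def by (rule lipschitz_onD[OF lip(2) cp cp])
    also have "\<dots> \<le> L * dist x y"
      using lip(1) L by (intro mult_left_mono closest_point_lipschitz) auto
    finally show "dist (H x) (H y) \<le> L * dist x y" .
  qed
  moreover have "norm (H x) \<le> L * s" for x
  proof -
    have "dist (H x) (F x\<^sub>0) \<le> L * dist (closest_point (cball x\<^sub>0 s) x) x\<^sub>0"
      unfolding H_def using lip(1) by (intro lipschitz_onD[OF lip(2) cp]) auto
    also have "\<dots> \<le> L * s" using cp[of x] L by (intro mult_left_mono) (auto simp: dist_commute)
    finally show ?thesis by (simp add: F(2) dist_norm)
  qed
  ultimately obtain x where x: "x 0 = x\<^sub>0 + l *\<^sub>R w"
    "\<And>t. t \<ge> 0 \<Longrightarrow> (x has_vector_derivative H (x t)) (at t within {0..})"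
    using ode_global_solution by metis
  have H: "H y = F y" if "dist y x\<^sub>0 < e" for y
    using that e by (simp add: H_def closest_point_self dist_commute)
  have x0: "dist (x 0) x\<^sub>0 < d" "dist (x 0) x\<^sub>0 < e / 2"
    using l by (auto simp: x(1) dist_norm)
  have contx: "continuous_on {0..} x"
    using x(2) by (intro continuous_on_vector_derivative) auto
  have contd: "continuous_on {0..t} (\<lambda>w. dist (x w) x\<^sub>0)" for t
    by (intro continuous_intros continuous_on_subset[OF contx]) auto

  have near: "dist (x t) x\<^sub>0 < e" if "t \<ge> 0" for t
  proof (rule ccontr)
    assume "\<not> ?thesis"
    then obtain u where u: "0 < u" "u \<le> t" "dist (x u) x\<^sub>0 = e"
      "\<And>w. 0 \<le> w \<Longrightarrow> w < u \<Longrightarrow> dist (x w) x\<^sub>0 < e"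
      using first_crossing[OF contd \<open>t \<ge> 0\<close>, of e] x0 e(1) by (smt (verit) half_gt_zero field_sum_of_halves)
    \<comment> \<open>Up to its first exit the curve solves the original equation, so stability keeps it at
        distance below \<open>e / 2\<close>; by continuity it cannot then be at distance \<open>e\<close>.\<close>
    have "sol {0..<u} x"
    proof (rule sol)
      fix t' assume t': "t' \<in> {0..<u}"
      hence n: "dist (x t') x\<^sub>0 < e" using u(4) by auto
      have "(x has_vector_derivative H (x t')) (at t' within {0..<u})"
        by (rule has_vector_derivative_within_subset[OF x(2)]) (use t' in auto)
      thus "x t' \<in> cball x\<^sub>0 s \<and> (x has_vector_derivative F (x t')) (at t' within {0..<u})"
        using H[OF n] n e by (auto simp: dist_commute)
    qed
    hence half: "dist (x t') x\<^sub>0 < e / 2" if "t' \<in> {0..<u}" for t'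
      using d(2)[OF u(1)] x0 that by blast
    obtain t' where t': "0 \<le> t'" "t' \<le> u" "dist (x t') x\<^sub>0 = 3 * e / 4"
      using IVT'[of "\<lambda>w. dist (x w) x\<^sub>0" 0 "3 * e / 4" u] contd u x0 e(1) by auto
    have "t' \<noteq> u" using t' u e(1) by auto
    thus False using half[of t'] t' e(1) by auto
  qed

  have dV: "((\<lambda>t. V (x t)) has_derivative (\<lambda>h. V' (x t) * h)) (at t within {0..T})"
    if "0 \<le> t" "t \<le> T" for t T
  proof -
    have "(x has_vector_derivative F (x t)) (at t within {0..T})"
      using has_vector_derivative_within_subset[OF x(2)[OF that(1)]] H[OF near[OF that(1)]] by auto
    from quadratic_form_derivative[OF P sym this]
    show ?thesis unfolding V_def V'_def by (simp add: has_field_derivative_def)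
  qed
  have V0: "V (x 0) > 0"
    using l(1) pos by (simp add: V_def x(1) linear_scale[OF bounded_linear.linear[OF P]])
  have mono: "V (x 0) \<le> V (x t)" if "t \<ge> 0" for t
  proof (cases "t = 0")
    case False
    hence t: "0 < t" using that by simp
    obtain u where u: "u \<in> {0<..<t}" "V (x t) - V (x 0) = V' (x u) * (t - 0)"
      using mvt_simple[OF t dV] by auto
    have "0 \<le> c * ((x u - x\<^sub>0) \<bullet> (x u - x\<^sub>0))" using growth(1) by simp
    also have "\<dots> \<le> V' (x u)" using u by (intro V' near) auto
    finally show ?thesis using u t by (smt (verit) mult_nonneg_nonneg)
  qed simp
  define k where "k = c / \<beta> * V (x 0)"
  have k: "k > 0" using growth(1) \<beta>(1) V0 by (simp add: k_def)
  have kV': "k \<le> V' (x t)" if "t \<ge> 0" for t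
  proof -
    have "k \<le> c / \<beta> * V (x t)" unfolding k_def
      using growth(1) \<beta>(1) mono[OF that] by (intro mult_left_mono) auto
    also have "\<dots> \<le> c / \<beta> * (\<beta> * (dist (x t) x\<^sub>0)\<^sup>2)"
      using growth(1) \<beta>(1) by (intro mult_left_mono Vup) auto
    also have "\<dots> = c * ((x t - x\<^sub>0) \<bullet> (x t - x\<^sub>0))" using \<beta>(1) by (simp add: dist2)
    also have "\<dots> \<le> V' (x t)" by (rule V'[OF near[OF that]])
    finally show ?thesis .
  qed
  \<comment> \<open>By this time linear growth has carried \<open>V\<close> past its upper bound \<open>\<beta> e\<^sup>2\<close> on the ball.\<close>
  define T where "T = \<beta> * e\<^sup>2 / k"
  have T: "T > 0" unfolding T_def using \<beta>(1) e(1) k by (intro divide_pos_pos mult_pos_pos zero_less_power)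
  obtain u where u: "u \<in> {0<..<T}" "V (x T) - V (x 0) = V' (x u) * (T - 0)"
    using mvt_simple[OF T dV] by auto
  have "k * T \<le> V' (x u) * T" using kV'[of u] u T by (intro mult_right_mono) auto
  hence "\<beta> * e\<^sup>2 < V (x T)" using u V0 k by (simp add: T_def)
  also have "\<dots> \<le> \<beta> * (dist (x T) x\<^sub>0)\<^sup>2" by (rule Vup)
  also have "\<dots> \<le> \<beta> * e\<^sup>2"
    using \<beta>(1) near[of T] T by (intro mult_left_mono power_mono) auto
  finally show False by simp
qed

section \<open>Hyperbolic equilibria in the plane\<close>

lemma mem_eigenvalues_iff_det:
  fixes A :: "real^'n^'n"
  shows "\<mu> \<in> eigenvalues A \<longleftrightarrow> det (cmat A - mat \<mu>) = 0"
proof -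
  have "(cmat A - mat \<mu>) *v v = 0 \<longleftrightarrow> cmat A *v v = \<mu> *s v" for v
  proof -
    have "mat \<mu> *v v = \<mu> *s v"
      by (simp add: vec_eq_iff matrix_vector_mult_def mat_def if_distrib if_distribR cong: if_cong)
    thus ?thesis by (simp add: matrix_vector_mult_diff_rdistrib)
  qed
  moreover have "invertible B \<longleftrightarrow> (\<forall>v. B *v v = 0 \<longrightarrow> v = 0)" for B :: "complex^'n^'n"
    by (simp add: invertible_left_inverse matrix_left_invertible_ker)
  ultimately show ?thesis
    unfolding eigenvalues_def using invertible_det_nz[of "cmat A - mat \<mu>"] by auto
qed

lemma eigenvalues_2:
  fixes A :: "real^2^2"
  obtains z\<^sub>1 z\<^sub>2 where "eigenvalues A = {z\<^sub>1, z\<^sub>2}"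
    "z\<^sub>1 + z\<^sub>2 = of_real (trace A)" "z\<^sub>1 * z\<^sub>2 = of_real (det A)"
proof -
  define s where "s = complex_of_real (trace A)"
  define p where "p = complex_of_real (det A)"
  define q where "q = csqrt (s\<^sup>2 - 4 * p)"
  define z\<^sub>1 where "z\<^sub>1 = (s + q) / 2"
  define z\<^sub>2 where "z\<^sub>2 = (s - q) / 2"
  have sum: "z\<^sub>1 + z\<^sub>2 = s" by (simp add: z\<^sub>1_def z\<^sub>2_def flip: add_divide_distrib)
  have "z\<^sub>1 * z\<^sub>2 = (s\<^sup>2 - q\<^sup>2) / 4"
    by (simp add: z\<^sub>1_def z\<^sub>2_def power2_eq_square algebra_simps)
  hence prod: "z\<^sub>1 * z\<^sub>2 = p" by (simp add: q_def)
  have "\<mu> \<in> eigenvalues A \<longleftrightarrow> \<mu> = z\<^sub>1 \<or> \<mu> = z\<^sub>2" for \<mu>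
  proof -
    have "det (cmat A - mat \<mu>) = \<mu>\<^sup>2 - s * \<mu> + p"
      by (simp add: det_2 cmat_def mat_def s_def p_def trace_def sum_2 power2_eq_square algebra_simps)
    also have "\<dots> = (\<mu> - z\<^sub>1) * (\<mu> - z\<^sub>2)"
      by (simp add: power2_eq_square algebra_simps flip: sum prod)
    finally show ?thesis by (simp add: mem_eigenvalues_iff_det)
  qed
  thus ?thesis using that[of z\<^sub>1 z\<^sub>2] sum prod by (auto simp: s_def p_def)
qed

text \<open>Trace and determinant are the sum and the product of the eigenvalues. Both are real, so the
imaginary parts are opposite and enter the determinant as a nonnegative square.\<close>

lemma eigenvalues_2_sink:
  fixes A :: "real^2^2"
  assumes "\<forall>\<mu>\<in>eigenvalues A. Re \<mu> < 0"
  shows "trace A < 0 \<and> det A > 0"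
proof -
  obtain z\<^sub>1 z\<^sub>2 where z: "eigenvalues A = {z\<^sub>1, z\<^sub>2}"
    "z\<^sub>1 + z\<^sub>2 = of_real (trace A)" "z\<^sub>1 * z\<^sub>2 = of_real (det A)"
    using eigenvalues_2 .
  have neg: "Re z\<^sub>1 < 0" "Re z\<^sub>2 < 0" using assms z(1) by auto
  have "trace A = Re z\<^sub>1 + Re z\<^sub>2" using arg_cong[OF z(2), of Re] by simp
  moreover have "Im z\<^sub>2 = - Im z\<^sub>1" using arg_cong[OF z(2), of Im] by simp
  hence "det A = Re z\<^sub>1 * Re z\<^sub>2 + (Im z\<^sub>1)\<^sup>2"
    using arg_cong[OF z(3), of Re] by (simp add: power2_eq_square)
  ultimately show ?thesis
    using neg mult_neg_neg[OF neg] by (auto intro: add_pos_nonneg)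
qed

text \<open>Real parts of opposite sign force real eigenvalues (the product is real), so the
determinant is negative; otherwise both eigenvalues lie in the right half-plane.\<close>

lemma eigenvalues_2_unstable:
  fixes A :: "real^2^2"
  assumes "\<forall>\<mu>\<in>eigenvalues A. Re \<mu> \<noteq> 0" "\<exists>\<mu>\<in>eigenvalues A. Re \<mu> > 0"
  shows "det A < 0 \<or> (trace A > 0 \<and> det A > 0)"
proof -
  obtain z\<^sub>1 z\<^sub>2 where z: "eigenvalues A = {z\<^sub>1, z\<^sub>2}"
    "z\<^sub>1 + z\<^sub>2 = of_real (trace A)" "z\<^sub>1 * z\<^sub>2 = of_real (det A)"
    using eigenvalues_2 .
  have nz: "Re z\<^sub>1 \<noteq> 0" "Re z\<^sub>2 \<noteq> 0" and pos: "Re z\<^sub>1 > 0 \<or> Re z\<^sub>2 > 0" using assms z(1) by auto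
  have tr: "trace A = Re z\<^sub>1 + Re z\<^sub>2" using arg_cong[OF z(2), of Re] by simp
  have im: "Im z\<^sub>2 = - Im z\<^sub>1" using arg_cong[OF z(2), of Im] by simp
  have det: "det A = Re z\<^sub>1 * Re z\<^sub>2 + (Im z\<^sub>1)\<^sup>2"
    using arg_cong[OF z(3), of Re] by (simp add: power2_eq_square im)
  have im0: "Im z\<^sub>1 * (Re z\<^sub>2 - Re z\<^sub>1) = 0"
    using arg_cong[OF z(3), of Im] by (simp add: im algebra_simps)
  show ?thesis
  proof (cases "Re z\<^sub>1 > 0 \<and> Re z\<^sub>2 > 0")
    case True
    thus ?thesis using tr det by (auto intro: add_pos_nonneg)
  next
    case False
    hence opp: "Re z\<^sub>1 * Re z\<^sub>2 < 0" using nz pos by (auto simp: mult_less_0_iff)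
    hence "Re z\<^sub>1 \<noteq> Re z\<^sub>2" by (metis not_square_less_zero)
    hence "Im z\<^sub>1 = 0" using im0 by simp
    thus ?thesis using det opp by simp
  qed
qed

lemma symmetric_2_selfadjoint:
  fixes P :: "real^2^2"
  assumes "P $ 1 $ 2 = P $ 2 $ 1"
  shows "(P *v y) \<bullet> z = y \<bullet> (P *v z)"
  using assms by (simp add: inner_vec_def matrix_vector_mult_def sum_2 algebra_simps)

text \<open>The matrix \<open>det A I + adj(A)\<^sup>T adj(A)\<close> with the adjugate \<open>adj(A)\<close>. Up to the factor
\<open>- 1 / (2 trace A det A)\<close> it is the solution \<open>P\<close> of the Lyapunov equation \<open>A\<^sup>T P + P A = - I\<close>.\<close>

definition lyapunov_matrix_2 :: "real^2^2 \<Rightarrow> real^2^2" where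
  "lyapunov_matrix_2 A =
     vector [vector [det A + (A$2$1)\<^sup>2 + (A$2$2)\<^sup>2, - (A$1$1 * A$2$1 + A$1$2 * A$2$2)],
             vector [- (A$1$1 * A$2$1 + A$1$2 * A$2$2), det A + (A$1$1)\<^sup>2 + (A$1$2)\<^sup>2]]"

text \<open>From \<open>adj(A) A = det A I\<close> and \<open>adj(A) = trace A I - A\<close> the quadratic form grows along the linear
flow at a rate proportional to \<open>trace A det A |y|\<^sup>2\<close>. For positive determinant it is positive definite,
so it serves sinks and sources alike, according to the sign of the trace.\<close>

lemma lyapunov_matrix_2:
  fixes A :: "real^2^2"
  shows "(lyapunov_matrix_2 A *v y) \<bullet> z = y \<bullet> (lyapunov_matrix_2 A *v z)"
    and "(lyapunov_matrix_2 A *v y) \<bullet> (A *v y) = trace A * det A * (y \<bullet> y)"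
    and "det A * (y \<bullet> y) \<le> y \<bullet> (lyapunov_matrix_2 A *v y)"
proof -
  show "(lyapunov_matrix_2 A *v y) \<bullet> z = y \<bullet> (lyapunov_matrix_2 A *v z)"
    by (rule symmetric_2_selfadjoint) (simp add: lyapunov_matrix_2_def)
  show "(lyapunov_matrix_2 A *v y) \<bullet> (A *v y) = trace A * det A * (y \<bullet> y)"
    by (simp add: lyapunov_matrix_2_def inner_vec_def matrix_vector_mult_def sum_2 det_2 trace_def)
       algebra
  have "y \<bullet> (lyapunov_matrix_2 A *v y) = det A * (y \<bullet> y) +
      (A$2$2 * y$1 - A$1$2 * y$2)\<^sup>2 + (A$1$1 * y$2 - A$2$1 * y$1)\<^sup>2"
    by (simp add: lyapunov_matrix_2_def inner_vec_def matrix_vector_mult_def sum_2) algebra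
  thus "det A * (y \<bullet> y) \<le> y \<bullet> (lyapunov_matrix_2 A *v y)" by simp
qed

text \<open>Twice the symmetric part of the traceless matrix \<open>A - (trace A / 2) I\<close>.\<close>

definition chetaev_matrix_2 :: "real^2^2 \<Rightarrow> real^2^2" where
  "chetaev_matrix_2 A = vector [vector [A$1$1 - A$2$2, A$1$2 + A$2$1],
                               vector [A$1$2 + A$2$1, A$2$2 - A$1$1]]"

text \<open>A form for saddles, where the trace may vanish and the Lyapunov equation may be unsolvable. By
Cayley-Hamilton the square of \<open>B = A - (trace A / 2) I\<close> is a multiple of the identity, which gives the
rate \<open>|A y|\<^sup>2 - det A |y|\<^sup>2\<close>. A traceless form takes positive values unless it vanishes, and it can
vanish only if \<open>A\<close> is a multiple of the identity plus a skew matrix, whose determinant is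
nonnegative.\<close>

lemma chetaev_matrix_2:
  fixes A :: "real^2^2"
  shows "(chetaev_matrix_2 A *v y) \<bullet> z = y \<bullet> (chetaev_matrix_2 A *v z)"
    and "- det A * (y \<bullet> y) \<le> (chetaev_matrix_2 A *v y) \<bullet> (A *v y)"
    and "det A < 0 \<Longrightarrow> \<exists>w. w \<bullet> (chetaev_matrix_2 A *v w) > 0"
proof -
  show "(chetaev_matrix_2 A *v y) \<bullet> z = y \<bullet> (chetaev_matrix_2 A *v z)"
    by (rule symmetric_2_selfadjoint) (simp add: chetaev_matrix_2_def)
  have "(chetaev_matrix_2 A *v y) \<bullet> (A *v y) = (A *v y) \<bullet> (A *v y) - det A * (y \<bullet> y)"
    by (simp add: chetaev_matrix_2_def inner_vec_def matrix_vector_mult_def sum_2 det_2) algebra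
  thus "- det A * (y \<bullet> y) \<le> (chetaev_matrix_2 A *v y) \<bullet> (A *v y)" by simp
  have form: "w \<bullet> (chetaev_matrix_2 A *v w) =
      (A$1$1 - A$2$2) * ((w$1)\<^sup>2 - (w$2)\<^sup>2) + 2 * (A$1$2 + A$2$1) * (w$1 * w$2)" for w
    by (simp add: chetaev_matrix_2_def inner_vec_def matrix_vector_mult_def sum_2) algebra
  show "\<exists>w. w \<bullet> (chetaev_matrix_2 A *v w) > 0" if neg: "det A < 0"
  proof (rule ccontr)
    assume no: "\<not> ?thesis"
    hence le: "w \<bullet> (chetaev_matrix_2 A *v w) \<le> 0" for w by (meson not_le)
    have "A$1$1 = A$2$2"
      using le[of "vector [1, 0]"] le[of "vector [0, 1]"] unfolding form by simp
    moreover have "A$1$2 = - A$2$1"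
      using le[of "vector [1, 1]"] le[of "vector [1, -1]"] unfolding form by simp
    ultimately have "det A = (A$1$1)\<^sup>2 + (A$2$1)\<^sup>2"
      by (simp add: det_2 power2_eq_square)
    thus False using neg by (smt (verit) zero_le_power2)
  qed
qed

text \<open>The three open cases of a hyperbolic planar linearization: sink (negative trace, positive
determinant), source (both positive) and saddle (negative determinant), each with its explicit
quadratic form. The predicate \<open>sol\<close> leaves room for a restricted state space: its members are integral curves,
but an integral curve has to be a member only if it stays in the ball.\<close>

theorem planar_linearized_stability:
  fixes F :: "real^2 \<Rightarrow> real^2" and J :: "real^2^2"
  assumes F: "(F has_derivative (*v) J) (at x\<^sub>0)" "F x\<^sub>0 = 0"
    and lip: "0 < s" "L-lipschitz_on (cball x\<^sub>0 s) F"
    and hyperbolic: "\<forall>\<mu>\<in>eigenvalues J. Re \<mu> \<noteq> 0"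
    and sol_ode: "\<And>T x t. sol T x \<Longrightarrow> t \<in> T \<Longrightarrow>
        (x has_vector_derivative F (x t)) (at t within T)"
    and ode_sol: "\<And>\<tau> x. (\<And>t. t \<in> {0..<\<tau>} \<Longrightarrow> x t \<in> cball x\<^sub>0 s \<and>
        (x has_vector_derivative F (x t)) (at t within {0..<\<tau>})) \<Longrightarrow> sol {0..<\<tau>} x"
  shows "(asymptotically_stable sol x\<^sub>0 \<longleftrightarrow> (\<forall>\<mu>\<in>eigenvalues J. Re \<mu> < 0)) \<and>
         (\<not> lyapunov_stable sol x\<^sub>0 \<longleftrightarrow> (\<exists>\<mu>\<in>eigenvalues J. Re \<mu> > 0))"
proof -
  have sink: "asymptotically_stable sol x\<^sub>0" if "\<forall>\<mu>\<in>eigenvalues J. Re \<mu> < 0"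
  proof -
    have tr: "trace J < 0" and det: "det J > 0" using eigenvalues_2_sink[OF that] by auto
    show ?thesis
    proof (rule linearized_sink_asymptotically_stable[OF F, of "(*v) (lyapunov_matrix_2 J)"])
      show "det J > 0" by fact
      show "- (trace J * det J) > 0" using tr det by (simp add: mult_neg_pos)
      show "(lyapunov_matrix_2 J *v y) \<bullet> (J *v y) \<le> - (- (trace J * det J) * (y \<bullet> y))" for y
        by (simp add: lyapunov_matrix_2(2))
    qed (simp_all add: lyapunov_matrix_2(1,3) sol_ode)
  qed
  have unstable: "\<not> lyapunov_stable sol x\<^sub>0" if "\<exists>\<mu>\<in>eigenvalues J. Re \<mu> > 0"
    using eigenvalues_2_unstable[OF hyperbolic that]
  proof
    assume det: "det J < 0"
    then obtain w where w: "w \<bullet> (chetaev_matrix_2 J *v w) > 0" using chetaev_matrix_2(3) by blast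
    show ?thesis
    proof (rule linearized_growth_not_stable[OF F lip, of "(*v) (chetaev_matrix_2 J)"])
      show "- det J > 0" using det by simp
      show "- det J * (y \<bullet> y) \<le> (chetaev_matrix_2 J *v y) \<bullet> (J *v y)" for y
        by (rule chetaev_matrix_2(2))
    qed (use w ode_sol in \<open>simp_all add: chetaev_matrix_2(1)\<close>)
  next
    assume *: "0 < trace J \<and> 0 < det J"
    define w :: "real^2" where "w = axis 1 1"
    have "w \<bullet> w > 0" by (simp add: w_def axis_eq_0_iff)
    hence "det J * (w \<bullet> w) > 0" using * by simp
    also have "\<dots> \<le> w \<bullet> (lyapunov_matrix_2 J *v w)" by (rule lyapunov_matrix_2(3))
    finally have w: "w \<bullet> (lyapunov_matrix_2 J *v w) > 0" .
    show ?thesis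
    proof (rule linearized_growth_not_stable[OF F lip, of "(*v) (lyapunov_matrix_2 J)"])
      show "trace J * det J > 0" using * by simp
      show "trace J * det J * (y \<bullet> y) \<le> (lyapunov_matrix_2 J *v y) \<bullet> (J *v y)" for y
        by (simp add: lyapunov_matrix_2(2))
    qed (use w ode_sol in \<open>simp_all add: lyapunov_matrix_2(1)\<close>)
  qed
  have "asymptotically_stable sol x\<^sub>0 \<Longrightarrow> lyapunov_stable sol x\<^sub>0"
    by (simp add: asymptotically_stable_def)
  moreover have "(\<forall>\<mu>\<in>eigenvalues J. Re \<mu> < 0) \<or> (\<exists>\<mu>\<in>eigenvalues J. Re \<mu> > 0)"
    using hyperbolic by force
  moreover have "\<not> ((\<forall>\<mu>\<in>eigenvalues J. Re \<mu> < 0) \<and> (\<exists>\<mu>\<in>eigenvalues J. Re \<mu> > 0))"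
    by force
  ultimately show ?thesis using sink unstable by blast
qed

section \<open>Termwise differentiation of unordered sums\<close>

lemma summable_on_norm_bound:
  fixes f :: "'i \<Rightarrow> 'b::banach"
  assumes "M summable_on I" "\<And>i. i \<in> I \<Longrightarrow> norm (f i) \<le> M i"
  shows "f summable_on I" "norm (infsum f I) \<le> infsum M I"
proof -
  have "(\<lambda>i. norm (M i)) summable_on I"
    using assms(1) order_trans[OF norm_ge_zero assms(2)]
    by (subst summable_on_cong[where g = M]) auto
  moreover have "norm (f i) \<le> norm (M i)" if "i \<in> I" for i
    using assms(2)[OF that] by simp
  ultimately have abs: "(\<lambda>i. norm (f i)) summable_on I" by (rule Infinite_Sum.abs_summable_on_comparison_test)
  thus "f summable_on I" by (rule abs_summable_summable)
  have "norm (infsum f I) \<le> infsum (\<lambda>i. norm (f i)) I" by (rule norm_infsum_bound[OF abs])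
  also have "\<dots> \<le> infsum M I" by (rule infsum_mono[OF abs assms])
  finally show "norm (infsum f I) \<le> infsum M I" .
qed

lemma infsum_small_tail:
  fixes M :: "'i \<Rightarrow> real"
  assumes "M summable_on I" "e > 0"
  obtains F where "finite F" "F \<subseteq> I" "infsum M (I - F) < e"
proof -
  have "(sum M \<longlongrightarrow> infsum M I) (finite_subsets_at_top I)"
    using infsum_tendsto[OF assms(1)] .
  hence "\<forall>\<^sub>F F in finite_subsets_at_top I. dist (sum M F) (infsum M I) < e"
    using assms(2) by (rule tendstoD)
  then obtain F where F: "finite F" "F \<subseteq> I" "dist (sum M F) (infsum M I) < e"
    unfolding eventually_finite_subsets_at_top by blast
  have "infsum M I = infsum M F + infsum M (I - F)"
    using infsum_Un_disjoint[of M F "I - F"] F assms(1)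
    by (simp add: Un_absorb1 summable_on_subset_banach)
  hence "infsum M (I - F) < e" using F by (simp add: dist_real_def)
  thus ?thesis using that F by blast
qed

text \<open>Weierstrass' test for unordered sums. A finite part of the sum is differentiated termwise; by the mean
value inequality the increments of the remaining terms are bounded by the same summable majorant as
their derivatives, so the tail of the majorant controls both.\<close>

lemma has_derivative_infsum:
  fixes T :: "'i \<Rightarrow> 'a::real_normed_vector \<Rightarrow> 'b::banach"
  assumes X: "convex X" "open X" "x \<in> X"
    and deriv: "\<And>i x. i \<in> I \<Longrightarrow> x \<in> X \<Longrightarrow> (T i has_derivative D i x) (at x)"
    and bound: "\<And>i x h. i \<in> I \<Longrightarrow> x \<in> X \<Longrightarrow> norm (D i x h) \<le> M i * norm h"
    and M: "\<And>i. i \<in> I \<Longrightarrow> 0 \<le> M i" "M summable_on I"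
    and T: "\<And>x. x \<in> X \<Longrightarrow> (\<lambda>i. T i x) summable_on I"
  shows "((\<lambda>x. \<Sum>\<^sub>\<infinity>i\<in>I. T i x) has_derivative (\<lambda>h. \<Sum>\<^sub>\<infinity>i\<in>I. D i x h)) (at x)"
proof -
  define D' where "D' h = (\<Sum>\<^sub>\<infinity>i\<in>I. D i x h)" for h
  have Mh: "(\<lambda>i. M i * norm h) summable_on J" if "J \<subseteq> I" for J and h :: 'a
    using summable_on_subset_banach[OF M(2) that] by (rule summable_on_cmult_left)
  have D_summable: "(\<lambda>i. D i x h) summable_on J" if "J \<subseteq> I" for J h
    by (rule summable_on_norm_bound(1)[OF Mh]) (use that bound X in auto)
  have D_bound: "norm (\<Sum>\<^sub>\<infinity>i\<in>J. D i x h) \<le> infsum M J * norm h" if "J \<subseteq> I" for J h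
  proof -
    have "norm (\<Sum>\<^sub>\<infinity>i\<in>J. D i x h) \<le> (\<Sum>\<^sub>\<infinity>i\<in>J. M i * norm h)"
      by (rule summable_on_norm_bound(2)[OF Mh]) (use that bound X in auto)
    thus ?thesis by (simp add: infsum_cmult_left')
  qed
  have lin: "linear (D i x)" if "i \<in> I" for i
    using deriv[OF that X(3)] by (rule has_derivative_linear)
  have "bounded_linear D'"
  proof (rule bounded_linear_intro[where K = "infsum M I"])
    fix h h' :: 'a and r :: real
    show "D' (h + h') = D' h + D' h'"
      unfolding D'_def
      by (subst infsum_add[symmetric]) (auto intro!: infsum_cong D_summable simp: linear_add[OF lin])
    show "D' (r *\<^sub>R h) = r *\<^sub>R D' h"
      unfolding D'_def
      by (subst infsum_scaleR_right[symmetric]) (auto intro!: infsum_cong simp: linear_scale[OF lin])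
    show "norm (D' h) \<le> norm h * infsum M I"
      using D_bound[of I h] by (simp add: D'_def mult.commute)
  qed
  moreover have "\<exists>d>0. \<forall>y. norm (y - x) < d \<longrightarrow>
      norm ((\<Sum>\<^sub>\<infinity>i\<in>I. T i y) - (\<Sum>\<^sub>\<infinity>i\<in>I. T i x) - D' (y - x)) \<le> e * norm (y - x)"
    if e: "e > 0" for e
  proof -
    \<comment> \<open>One third of \<open>e\<close> each for the finite part, the tail of the increments and the tail of the
        derivatives.\<close>
    obtain F where F: "finite F" "F \<subseteq> I" "infsum M (I - F) < e / 3"
      using infsum_small_tail[OF M(2), of "e / 3"] e by auto
    have "((\<lambda>x. \<Sum>i\<in>F. T i x) has_derivative (\<lambda>h. \<Sum>i\<in>F. D i x h)) (at x)"
      by (intro has_derivative_sum deriv) (use F X in auto)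
    moreover have "e / 3 > 0" using e by simp
    ultimately obtain d\<^sub>1 where d\<^sub>1: "d\<^sub>1 > 0" "\<And>y. norm (y - x) < d\<^sub>1 \<Longrightarrow>
        norm ((\<Sum>i\<in>F. T i y) - (\<Sum>i\<in>F. T i x) - (\<Sum>i\<in>F. D i x (y - x))) \<le> e / 3 * norm (y - x)"
      unfolding has_derivative_at_alt by blast
    obtain d\<^sub>2 where d\<^sub>2: "d\<^sub>2 > 0" "ball x d\<^sub>2 \<subseteq> X"
      using X by (meson open_contains_ball)
    show ?thesis
    proof (intro exI[of _ "min d\<^sub>1 d\<^sub>2"] conjI allI impI)
      show "min d\<^sub>1 d\<^sub>2 > 0" using d\<^sub>1 d\<^sub>2 by simp
      fix y assume y: "norm (y - x) < min d\<^sub>1 d\<^sub>2"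
      hence "y \<in> X" using d\<^sub>2 by (auto simp: dist_norm norm_minus_commute subset_eq)
      have split: "infsum g I = sum g F + infsum g (I - F)" if "g summable_on I" for g :: "'i \<Rightarrow> 'b"
        using infsum_Un_disjoint[of g F "I - F"] F that
        by (simp add: Un_absorb1 summable_on_subset_banach)
      have T_tail: "(\<lambda>i. T i z) summable_on I - F" if "z \<in> X" for z
        using T[OF that] by (rule summable_on_subset_banach) auto
      define A where "A = (\<Sum>i\<in>F. T i y) - (\<Sum>i\<in>F. T i x) - (\<Sum>i\<in>F. D i x (y - x))"
      define B where "B = (\<Sum>\<^sub>\<infinity>i\<in>I - F. T i y) - (\<Sum>\<^sub>\<infinity>i\<in>I - F. T i x)"
      define C where "C = (\<Sum>\<^sub>\<infinity>i\<in>I - F. D i x (y - x))"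
      have "norm A \<le> e / 3 * norm (y - x)" using d\<^sub>1(2)[of y] y by (simp add: A_def)
      moreover have "norm B \<le> infsum M (I - F) * norm (y - x)"
      proof -
        have le: "norm (T i y - T i x) \<le> M i * norm (y - x)" if i: "i \<in> I" for i
        proof (rule differentiable_bound[OF X(1) _ _ \<open>y \<in> X\<close> X(3)])
          fix z assume z: "z \<in> X"
          show "(T i has_derivative D i z) (at z within X)"
            using deriv[OF i z] by (rule has_derivative_at_withinI)
          show "onorm (D i z) \<le> M i" by (rule onorm_bound[OF M(1)[OF i] bound[OF i z]])
        qed
        have "B = (\<Sum>\<^sub>\<infinity>i\<in>I - F. T i y - T i x)"
          unfolding B_def
          using infsum_add[OF T_tail[OF \<open>y \<in> X\<close>] summable_on_uminus[THEN iffD2, OF T_tail[OF X(3)]]]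
          by (simp add: infsum_uminus)
        also have "norm \<dots> \<le> (\<Sum>\<^sub>\<infinity>i\<in>I - F. M i * norm (y - x))"
          by (rule summable_on_norm_bound(2)[OF Mh]) (use le in auto)
        finally show ?thesis by (simp add: infsum_cmult_left')
      qed
      moreover have "norm C \<le> infsum M (I - F) * norm (y - x)"
        unfolding C_def by (rule D_bound) auto
      moreover have "infsum M (I - F) * norm (y - x) \<le> e / 3 * norm (y - x)"
        using F by (intro mult_right_mono) auto
      moreover have "(\<Sum>\<^sub>\<infinity>i\<in>I. T i y) - (\<Sum>\<^sub>\<infinity>i\<in>I. T i x) - D' (y - x) = A + B - C"
        unfolding A_def B_def C_def D'_def
        by (simp add: split[OF T[OF \<open>y \<in> X\<close>]] split[OF T[OF X(3)]] split[OF D_summable[OF order_refl]])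
      moreover have "norm (A + B - C) \<le> norm A + norm B + norm C"
        using norm_triangle_ineq4[of "A + B" C] norm_triangle_ineq[of A B] by linarith
      ultimately show "norm ((\<Sum>\<^sub>\<infinity>i\<in>I. T i y) - (\<Sum>\<^sub>\<infinity>i\<in>I. T i x) - D' (y - x)) \<le> e * norm (y - x)"
        by simp
    qed
  qed
  ultimately show ?thesis unfolding has_derivative_at_alt D'_def by blast
qed

section \<open>Polar monomials and their Jacobians\<close>

lemma vector_2_eq_axis: "(vector [a, b] :: real^2) = a *\<^sub>R axis 1 1 + b *\<^sub>R axis 2 1"
  by (simp add: vec_eq_iff forall_2 axis_def)

lemma bounded_linear_vector_2:
  assumes "bounded_linear f" "bounded_linear g"
  shows "bounded_linear (\<lambda>x. vector [f x, g x] :: real^2)"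
  unfolding vector_2_eq_axis
  by (intro bounded_linear_add bounded_linear_compose[OF bounded_linear_scaleR_left] assms)

lemma has_derivative_vector_2:
  assumes "(f has_derivative f') F" "(g has_derivative g') F"
  shows "((\<lambda>x. vector [f x, g x] :: real^2) has_derivative (\<lambda>h. vector [f' h, g' h])) F"
  unfolding vector_2_eq_axis
  by (intro has_derivative_add has_derivative_scaleR_left assms)

lemma bounded_linear_matrix_vector_left:
  fixes h :: "real^'n"
  shows "bounded_linear (\<lambda>A :: real^'n^'m. A *v h)"
  by (subst linear_conv_bounded_linear[symmetric])
     (auto intro!: linearI simp: matrix_vector_mult_add_rdistrib scaleR_matrix_vector_assoc)

lemma norm_matrix_2_le:
  fixes A :: "real^2^2"
  assumes "\<And>i j. \<bar>A $ i $ j\<bar> \<le> B"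
  shows "norm A \<le> 4 * B" "norm (A *v h) \<le> 4 * B * norm h"
proof -
  have B: "B \<ge> 0" using assms[of 1 1] by linarith
  have row: "norm (A $ i) \<le> 2 * B" for i
    using norm_le_l1_cart[of "A $ i"] assms[of i 1] assms[of i 2] by (simp add: sum_2)
  have "norm A \<le> norm (A $ 1) + norm (A $ 2)"
    unfolding norm_vec_def[of A] using L2_set_le_sum[of UNIV "\<lambda>i. norm (A $ i)"] by (simp add: sum_2)
  thus "norm A \<le> 4 * B" using row[of 1] row[of 2] by simp
  have comp: "\<bar>(A *v h) $ i\<bar> \<le> 2 * B * norm h" for i
  proof -
    have "\<bar>(A *v h) $ i\<bar> \<le> norm (A $ i) * norm h"
      by (simp add: matrix_vector_mul_component Cauchy_Schwarz_ineq2)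
    also have "\<dots> \<le> 2 * B * norm h" using row by (intro mult_right_mono) auto
    finally show ?thesis .
  qed
  show "norm (A *v h) \<le> 4 * B * norm h"
    using norm_le_l1_cart[of "A *v h"] comp[of 1] comp[of 2] by (simp add: sum_2)
qed

text \<open>The contribution of a complex velocity \<open>c \<rho>\<^sup>n exp (- i \<alpha> \<psi>)\<close> to \<open>(\<rho>', \<psi>')\<close> at \<open>x = (\<rho>, \<psi>)\<close>: real part,
and imaginary part divided by \<open>\<rho>\<close>. Integer powers are used because the angular exponent \<open>n - 1\<close> is
negative for \<open>n = 0\<close>.\<close>

definition mode_term :: "complex \<Rightarrow> nat \<Rightarrow> real \<Rightarrow> real^2 \<Rightarrow> real^2" where
  "mode_term c n \<alpha> x =
     vector [Re (c * cis (- (\<alpha> * x $ 2))) * x $ 1 powi int n,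
             Im (c * cis (- (\<alpha> * x $ 2))) * x $ 1 powi (int n - 1)]"

definition mode_jacobian :: "complex \<Rightarrow> nat \<Rightarrow> real \<Rightarrow> real^2 \<Rightarrow> real^2^2" where
  "mode_jacobian c n \<alpha> x =
     (let z = c * cis (- (\<alpha> * x $ 2)) in
      vector [vector [Re z * real n * x $ 1 powi (int n - 1), \<alpha> * Im z * x $ 1 powi int n],
              vector [Im z * (real n - 1) * x $ 1 powi (int n - 2),
                      - (\<alpha> * Re z * x $ 1 powi (int n - 1))]])"

lemma mode_term_has_derivative:
  assumes "x $ 1 \<noteq> 0"
  shows "(mode_term c n \<alpha> has_derivative (*v) (mode_jacobian c n \<alpha> x)) (at x)"
proof -
  have coord: "((\<lambda>x. x $ i) has_derivative (\<lambda>h. h $ i)) (at x)" for i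
    by (rule bounded_linear.has_derivative[OF bounded_linear_vec_nth has_derivative_ident])
  have re: "((\<lambda>t. Re (c * cis (- (\<alpha> * t)))) has_real_derivative \<alpha> * Im (c * cis (- (\<alpha> * t)))) (at t)"
    and im: "((\<lambda>t. Im (c * cis (- (\<alpha> * t)))) has_real_derivative - (\<alpha> * Re (c * cis (- (\<alpha> * t))))) (at t)"
    for t
    by (auto intro!: derivative_eq_intros simp: algebra_simps)
  have pow: "((\<lambda>s. s powi k) has_real_derivative of_int k * x $ 1 powi (k - 1)) (at (x $ 1))" for k
    using assms by (auto intro!: derivative_eq_intros)
  define u where "u = Re (c * cis (- (\<alpha> * x $ 2)))"
  define v where "v = Im (c * cis (- (\<alpha> * x $ 2)))"
  have "(*v) (mode_jacobian c n \<alpha> x) = (\<lambda>h. vector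
      [u * (h $ 1 * (of_int (int n) * x $ 1 powi (int n - 1))) + h $ 2 * (\<alpha> * v) * x $ 1 powi int n,
       v * (h $ 1 * (of_int (int n - 1) * x $ 1 powi (int n - 1 - 1))) +
         h $ 2 * (- (\<alpha> * u)) * x $ 1 powi (int n - 1)])"
    unfolding mode_jacobian_def Let_def u_def[symmetric] v_def[symmetric]
    by (rule ext) (simp add: vec_eq_iff forall_2 matrix_vector_mult_def sum_2 mult_ac)
  note eq = this[unfolded u_def v_def]
  show ?thesis
    unfolding eq mode_term_def[abs_def]
    by (intro has_derivative_vector_2 has_derivative_mult
        DERIV_compose_FDERIV[OF re coord] DERIV_compose_FDERIV[OF im coord]
        DERIV_compose_FDERIV[OF pow coord])
qed

text \<open>On an annulus \<open>a < \<rho> < b\<close> all entries are dominated by the coefficient times a linear factor in the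
degree: differentiation in \<open>\<rho>\<close> brings down \<open>n\<close>, differentiation in \<open>\<psi>\<close> brings down \<open>\<alpha>\<close>. The negative
powers of \<open>\<rho>\<close> cost at most \<open>1 / a\<^sup>2\<close>.\<close>

lemma mode_bounds:
  fixes c :: complex and x :: "real^2"
  assumes a: "0 < a" "a < x $ 1" "x $ 1 < b" and \<alpha>: "\<bar>\<alpha>\<bar> \<le> real n + 1"
  defines "B \<equiv> (1 + 1 / a)\<^sup>2 * (cmod c * (real n + 1) * b ^ n)"
  shows "\<bar>mode_jacobian c n \<alpha> x $ i $ j\<bar> \<le> B" "\<bar>mode_term c n \<alpha> x $ i\<bar> \<le> B"
proof -
  define s where "s = x $ 1"
  define z where "z = c * cis (- (\<alpha> * x $ 2))"
  \<comment> \<open>A single constant above \<open>1\<close>, \<open>1 / a\<close> and \<open>1 / a\<^sup>2\<close>.\<close>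
  define q where "q = (1 + 1 / a)\<^sup>2"
  have s: "0 < s" "a < s" "s < b" using a by (auto simp: s_def)
  have "q = 1 + 2 * (1 / a) + 1 / a\<^sup>2" by (simp add: q_def power2_eq_square algebra_simps)
  moreover have "1 / a > 0" "1 / a\<^sup>2 > 0" using a by auto
  ultimately have q: "1 \<le> q" "1 / a \<le> q" "1 / a\<^sup>2 \<le> q" by linarith+
  have sn: "0 \<le> s ^ n" "s ^ n \<le> b ^ n" using s by (auto intro: power_mono)
  have p0: "\<bar>s powi int n\<bar> \<le> q * b ^ n"
    using sn q(1) mult_mono[OF q(1) sn(2)] by simp
  have "s powi (int n - 1) = 1 / s * s ^ n" using s by (simp add: power_int_diff)
  also have "\<dots> \<le> 1 / a * b ^ n" using s a sn by (intro mult_mono) (auto intro: divide_left_mono)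
  also have "\<dots> \<le> q * b ^ n" using q sn by (intro mult_right_mono) auto
  finally have p1: "\<bar>s powi (int n - 1)\<bar> \<le> q * b ^ n" using s by simp
  have "s powi (int n - 2) = 1 / s\<^sup>2 * s ^ n" using s by (simp add: power_int_diff)
  also have "\<dots> \<le> 1 / a\<^sup>2 * b ^ n"
    using s a sn by (intro mult_mono divide_left_mono power_mono) auto
  also have "\<dots> \<le> q * b ^ n" using q sn by (intro mult_right_mono) auto
  finally have p2: "\<bar>s powi (int n - 2)\<bar> \<le> q * b ^ n" using s by simp
  have z: "\<bar>Re z\<bar> \<le> cmod c" "\<bar>Im z\<bar> \<le> cmod c"
    using abs_Re_le_cmod[of z] abs_Im_le_cmod[of z] by (simp_all add: z_def norm_mult)
  have prod: "\<bar>u * k * p\<bar> \<le> B" if "\<bar>u\<bar> \<le> cmod c" "\<bar>k\<bar> \<le> real n + 1" "\<bar>p\<bar> \<le> q * b ^ n" for u k p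
  proof -
    have "\<bar>u * k * p\<bar> \<le> cmod c * (real n + 1) * (q * b ^ n)"
      unfolding abs_mult using that by (intro mult_mono) auto
    thus ?thesis by (simp add: B_def q_def mult_ac)
  qed
  have J: "mode_jacobian c n \<alpha> x =
    vector [vector [Re z * real n * s powi (int n - 1), Im z * \<alpha> * s powi int n],
            vector [Im z * (real n - 1) * s powi (int n - 2), Re z * (- \<alpha>) * s powi (int n - 1)]]"
    by (simp add: mode_jacobian_def Let_def z_def s_def mult_ac)
  have "\<forall>i j. \<bar>mode_jacobian c n \<alpha> x $ i $ j\<bar> \<le> B"
    unfolding J forall_2 by (simp only: vector_2) (intro conjI prod z p0 p1 p2; use \<alpha> in linarith)
  thus "\<bar>mode_jacobian c n \<alpha> x $ i $ j\<bar> \<le> B" by blast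
  have "mode_term c n \<alpha> x = vector [Re z * 1 * s powi int n, Im z * 1 * s powi (int n - 1)]"
    by (simp add: mode_term_def z_def s_def)
  hence "\<forall>i. \<bar>mode_term c n \<alpha> x $ i\<bar> \<le> B"
    unfolding forall_2 by (simp only: vector_2) (intro conjI prod z p0 p1; simp)
  thus "\<bar>mode_term c n \<alpha> x $ i\<bar> \<le> B" by blast
qed

text \<open>As for power series, a factor linear in the degree does not shrink the domain of convergence; by
Bernoulli's inequality \<open>n + 1\<close> is at most a multiple of \<open>(s / b)\<^sup>n\<close>.\<close>

lemma summable_on_degree_weight:
  assumes "0 < b" "b < s" "(\<lambda>i. cmod (c i) * s ^ n i) summable_on I"
  shows "(\<lambda>i. cmod (c i) * (real (n i) + 1) * b ^ n i) summable_on I"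
proof -
  define q where "q = s / b - 1"
  have q: "q > 0" using assms by (simp add: q_def)
  have "norm (cmod (c i) * (real (n i) + 1) * b ^ n i) \<le> (1 + 1 / q) * (cmod (c i) * s ^ n i)" for i
  proof -
    have "real (n i) + 1 \<le> (1 + 1 / q) * (1 + real (n i) * q)"
      using q by (simp add: field_simps)
    also have "\<dots> \<le> (1 + 1 / q) * (1 + q) ^ n i"
      using q by (intro mult_left_mono Bernoulli_inequality) auto
    also have "(1 + q) ^ n i = s ^ n i / b ^ n i" by (simp add: q_def power_divide)
    finally have "(real (n i) + 1) * b ^ n i \<le> (1 + 1 / q) * s ^ n i"
      using assms(1) by (simp add: field_simps)
    from mult_left_mono[OF this norm_ge_zero[of "c i"]] show ?thesis
      using assms(1) by (simp add: abs_mult mult_ac)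
  qed
  thus ?thesis
    by (intro summable_on_norm_bound(1)[OF summable_on_cmult_right[OF assms(3)]])
qed

text \<open>The bound \<open>|\<alpha> i| \<le> n i + 1\<close> on the frequencies is what makes the derivative in \<open>\<psi>\<close> converge: it
has the same majorant as the derivative in \<open>\<rho>\<close>. The bound \<open>B\<close>, uniform on the annulus,
provides the Lipschitz constant of the polar field.\<close>

lemma mode_series:
  fixes c :: "'i \<Rightarrow> complex" and n :: "'i \<Rightarrow> nat" and \<alpha> :: "'i \<Rightarrow> real"
  assumes conv: "\<And>s. 0 \<le> s \<Longrightarrow> s < r \<Longrightarrow> (\<lambda>i. cmod (c i) * s ^ n i) summable_on I"
    and freq: "\<And>i. i \<in> I \<Longrightarrow> c i \<noteq> 0 \<Longrightarrow> \<bar>\<alpha> i\<bar> \<le> real (n i) + 1"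
    and ab: "0 < a" "a < b" "b < r"
  shows "\<exists>B. \<forall>x. a < x $ 1 \<and> x $ 1 < b \<longrightarrow>
      (\<lambda>i. mode_jacobian (c i) (n i) (\<alpha> i) x) summable_on I \<and>
      ((\<lambda>x. \<Sum>\<^sub>\<infinity>i\<in>I. mode_term (c i) (n i) (\<alpha> i) x) has_derivative
         (*v) (\<Sum>\<^sub>\<infinity>i\<in>I. mode_jacobian (c i) (n i) (\<alpha> i) x)) (at x) \<and>
      (\<forall>h. norm ((\<Sum>\<^sub>\<infinity>i\<in>I. mode_jacobian (c i) (n i) (\<alpha> i) x) *v h) \<le> B * norm h)"
proof -
  define T where "T i = mode_term (c i) (n i) (\<alpha> i)" for i
  define J where "J i = mode_jacobian (c i) (n i) (\<alpha> i)" for i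
  define N where "N i = (1 + 1 / a)\<^sup>2 * (cmod (c i) * (real (n i) + 1) * b ^ n i)" for i
  define X where "X = {x :: real^2. a < x $ 1 \<and> x $ 1 < b}"
  define M where "M i = 4 * N i" for i
  obtain s where s: "b < s" "s < r" using ab dense by blast
  have "(\<lambda>i. cmod (c i) * (real (n i) + 1) * b ^ n i) summable_on I"
    using summable_on_degree_weight[OF _ s(1) conv[OF _ s(2)]] ab s by auto
  hence M: "M summable_on I"
    unfolding M_def N_def by (intro summable_on_cmult_right)
  have bound: "\<bar>J i x $ k $ l\<bar> \<le> N i" "\<bar>T i x $ k\<bar> \<le> N i" if "i \<in> I" "x \<in> X" for i x k l
  proof -
    \<comment> \<open>The frequency bound covers nonzero coefficients; a vanishing term may be given frequency \<open>0\<close>.\<close>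
    define \<beta> where "\<beta> = (if c i = 0 then 0 else \<alpha> i)"
    have eq: "J i x = mode_jacobian (c i) (n i) \<beta> x" "T i x = mode_term (c i) (n i) \<beta> x"
      by (auto simp: J_def T_def \<beta>_def mode_jacobian_def mode_term_def vec_eq_iff forall_2)
    have \<beta>: "\<bar>\<beta>\<bar> \<le> real (n i) + 1" using freq[OF that(1)] by (auto simp: \<beta>_def)
    show "\<bar>J i x $ k $ l\<bar> \<le> N i" "\<bar>T i x $ k\<bar> \<le> N i"
      using mode_bounds[of a x b \<beta> "n i" "c i"] that \<beta> ab unfolding eq N_def by (auto simp: X_def)
  qed
  have N: "0 \<le> N i" for i using ab by (simp add: N_def)
  have J_norm: "norm (J i x) \<le> M i" "norm (J i x *v h) \<le> M i * norm h" if "i \<in> I" "x \<in> X" for i x h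
    using norm_matrix_2_le[of "J i x" "N i"] bound[OF that] by (auto simp: M_def)
  have T_norm: "norm (T i x) \<le> M i" if "i \<in> I" "x \<in> X" for i x
    using norm_le_l1_cart[of "T i x"] bound(2)[OF that, of 1] bound(2)[OF that, of 2] N[of i]
    by (simp add: sum_2 M_def)
  have T_summable: "(\<lambda>i. T i x) summable_on I" if "x \<in> X" for x
    by (rule summable_on_norm_bound(1)[OF M T_norm[OF _ that]])
  have J_summable: "(\<lambda>i. J i x) summable_on I" if "x \<in> X" for x
    by (rule summable_on_norm_bound(1)[OF M J_norm(1)[OF _ that]])
  have J_apply: "(\<Sum>\<^sub>\<infinity>i\<in>I. J i x) *v h = (\<Sum>\<^sub>\<infinity>i\<in>I. J i x *v h)" if "x \<in> X" for x h
    using infsumI[OF has_sum_bounded_linear[OF bounded_linear_matrix_vector_left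
          has_sum_infsum[OF J_summable[OF that]]], of h] by (simp add: o_def)
  have "convex X"
  proof -
    have "X = {x. a < axis 1 1 \<bullet> x} \<inter> {x. axis 1 1 \<bullet> x < b}" by (auto simp: X_def inner_axis')
    thus ?thesis by (simp add: convex_Int convex_halfspace_gt convex_halfspace_lt)
  qed
  moreover have "open X" unfolding X_def
    by (intro open_Collect_conj open_Collect_less continuous_intros)
  moreover have "(T i has_derivative (*v) (J i x)) (at x)" if "x \<in> X" for i x
    unfolding T_def J_def by (rule mode_term_has_derivative) (use that ab in \<open>auto simp: X_def\<close>)
  ultimately have deriv: "((\<lambda>x. \<Sum>\<^sub>\<infinity>i\<in>I. T i x) has_derivative (*v) (\<Sum>\<^sub>\<infinity>i\<in>I. J i x)) (at x)"
    if "x \<in> X" for x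
    using has_derivative_infsum[of X x I T "\<lambda>i x. (*v) (J i x)" M] that J_norm(2) M T_summable N
    by (simp add: J_apply[OF that, abs_def] M_def)
  have norm: "norm ((\<Sum>\<^sub>\<infinity>i\<in>I. J i x) *v h) \<le> infsum M I * norm h" if "x \<in> X" for x h
  proof -
    have "norm (\<Sum>\<^sub>\<infinity>i\<in>I. J i x *v h) \<le> (\<Sum>\<^sub>\<infinity>i\<in>I. M i * norm h)"
      by (rule summable_on_norm_bound(2)[OF summable_on_cmult_left[OF M]]) (use J_norm(2) that in auto)
    thus ?thesis by (simp add: J_apply[OF that] infsum_cmult_left')
  qed
  show ?thesis
    by (rule exI[of _ "infsum M I"])
       (use J_summable deriv norm in \<open>auto simp: T_def J_def X_def\<close>)
qed

section \<open>Near-resonances are exact index relations\<close>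

text \<open>The frequency of the mode is within \<open>\<delta>\<close> of a nonzero multiple of \<open>\<Omega> > 2 \<delta>\<close>. In particular the mode
is oscillatory, which makes distinct combinations of \<open>lam\<close> and \<open>cnj lam\<close> distinguishable.\<close>

lemma mode_frequency_exceeds_tolerance:
  assumes "\<Omega> > 0" "\<kappa>\<^sub>0 \<noteq> 0" "near_resonant \<eta> \<delta> lam lam \<Omega> (0, 0) \<kappa>\<^sub>0" "small_tolerance \<delta> \<Omega> S"
  shows "\<delta> < \<bar>Im lam\<bar>"
proof -
  have "\<bar>Im lam - of_int \<kappa>\<^sub>0 * \<Omega>\<bar> \<le> \<delta>"
    using assms(3) by (simp add: near_resonant_def Let_def)
  moreover have "\<Omega> \<le> \<bar>of_int \<kappa>\<^sub>0 * \<Omega>\<bar>"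
  proof -
    have "1 \<le> \<bar>real_of_int \<kappa>\<^sub>0\<bar>" using assms(2) by linarith
    thus ?thesis using assms(1) by (simp add: abs_mult)
  qed
  moreover have "2 * \<delta> < \<Omega>" using assms(4) by (simp add: small_tolerance_def)
  ultimately show ?thesis by linarith
qed

text \<open>The frequency mismatch is the integer multiple \<open>(1 - m\<^sub>1 + m\<^sub>2)\<close> of \<open>Im lam\<close>, which is larger than the
tolerance in absolute value unless the integer is zero.\<close>

lemma autonomous_resonance_exact:
  assumes freq: "\<delta> < \<bar>Im lam\<bar>" and near: "near_resonant \<eta> \<delta> lam lam \<Omega> m 0"
  shows "fst m = Suc (snd m)"
proof -
  define k where "k = 1 - int (fst m) + int (snd m)"
  have "Im lam - (real (fst m) * Im lam - real (snd m) * Im lam) = real_of_int k * Im lam"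
    by (simp add: k_def algebra_simps)
  hence "\<bar>real_of_int k\<bar> * \<bar>Im lam\<bar> \<le> \<delta>"
    using near by (simp add: near_resonant_def Let_def flip: abs_mult)
  also note freq
  finally have "\<bar>real_of_int k\<bar> * \<bar>Im lam\<bar> < 1 * \<bar>Im lam\<bar>" by simp
  hence "\<bar>real_of_int k\<bar> < 1" by (rule mult_right_less_imp_less) simp
  hence "k = 0" by linarith
  thus ?thesis by (simp add: k_def)
qed

text \<open>With \<open>k = 1 - m\<^sub>1 + m\<^sub>2\<close>, the two near-resonances say that \<open>k Im lam\<close> is close to both \<open>k \<kappa>\<^sub>0 \<Omega>\<close> and
\<open>\<kappa> \<Omega>\<close>. The accumulated error is below the spacing \<open>\<Omega>\<close> of the harmonics, so these multiples
of \<open>\<Omega>\<close> coincide.\<close>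

lemma forced_resonance_exact:
  assumes "\<Omega> > 0" and ext: "near_resonant \<eta> \<delta> lam lam \<Omega> (0, 0) \<kappa>\<^sub>0"
    and near: "near_resonant \<eta> \<delta> lam lam \<Omega> m \<kappa>"
    and tol: "(1 + \<bar>1 - real (fst m) + real (snd m)\<bar>) * \<delta> < \<Omega>"
  shows "\<kappa> = \<kappa>\<^sub>0 * (1 - int (fst m) + int (snd m))"
proof -
  define k where "k = 1 - int (fst m) + int (snd m)"
  define w where "w = Im lam"
  have k: "real_of_int k = 1 - real (fst m) + real (snd m)" by (simp add: k_def)
  have "\<bar>w - of_int \<kappa>\<^sub>0 * \<Omega>\<bar> \<le> \<delta>"
    using ext by (simp add: near_resonant_def Let_def w_def)
  hence "\<bar>real_of_int k\<bar> * \<bar>w - of_int \<kappa>\<^sub>0 * \<Omega>\<bar> \<le> \<bar>real_of_int k\<bar> * \<delta>"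
    by (rule mult_left_mono) simp
  hence 1: "\<bar>of_int k * w - of_int k * of_int \<kappa>\<^sub>0 * \<Omega>\<bar> \<le> \<bar>real_of_int k\<bar> * \<delta>"
    by (simp add: algebra_simps flip: abs_mult)
  have "\<bar>w - (real (fst m) * w - real (snd m) * w + of_int \<kappa> * \<Omega>)\<bar> \<le> \<delta>"
    using near by (simp add: near_resonant_def Let_def w_def)
  also have "w - (real (fst m) * w - real (snd m) * w + of_int \<kappa> * \<Omega>) = of_int k * w - of_int \<kappa> * \<Omega>"
    by (simp add: k algebra_simps)
  finally have 2: "\<bar>of_int k * w - of_int \<kappa> * \<Omega>\<bar> \<le> \<delta>" .
  have "\<bar>of_int (k * \<kappa>\<^sub>0 - \<kappa>) * \<Omega>\<bar> = \<bar>of_int k * of_int \<kappa>\<^sub>0 * \<Omega> - of_int \<kappa> * \<Omega>\<bar>"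
    by (simp add: algebra_simps)
  also have "\<dots> \<le> \<bar>real_of_int k\<bar> * \<delta> + \<delta>" using 1 2 by linarith
  also have "\<dots> < \<Omega>" using tol by (simp add: k algebra_simps)
  finally have "\<bar>real_of_int (k * \<kappa>\<^sub>0 - \<kappa>)\<bar> * \<Omega> < 1 * \<Omega>"
    using assms(1) by (simp add: abs_mult)
  hence "\<bar>real_of_int (k * \<kappa>\<^sub>0 - \<kappa>)\<bar> < 1"
    by (rule mult_right_less_imp_less) (use assms(1) in simp)
  hence "k * \<kappa>\<^sub>0 - \<kappa> = 0" by linarith
  thus ?thesis by (simp add: k_def mult.commute)
qed

section \<open>Reduced dynamics in the co-rotating polar frame\<close>

lemma polar_curve_velocity:
  assumes "(\<rho> has_real_derivative \<rho>') (at t)" "(\<theta> has_real_derivative \<theta>') (at t)"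
  shows "((\<lambda>t. of_real (\<rho> t) * exp (\<i> * of_real (\<theta> t))) has_vector_derivative
          cis (\<theta> t) * Complex \<rho>' (\<rho> t * \<theta>')) (at t)"
proof -
  have 1: "((\<lambda>t. complex_of_real (\<rho> t)) has_vector_derivative of_real \<rho>') (at t)"
    by (rule has_vector_derivative_of_real[OF assms(1)])
  have 2: "((\<lambda>t. complex_of_real (\<theta> t)) has_vector_derivative of_real \<theta>') (at t)"
    by (rule has_vector_derivative_of_real[OF assms(2)])
  have "((\<lambda>z. exp (\<i> * z)) has_field_derivative \<i> * exp (\<i> * of_real (\<theta> t))) (at (of_real (\<theta> t)))"
    by (auto intro!: derivative_eq_intros)
  from field_vector_diff_chain_at[OF 2 this]
  have 3: "((\<lambda>t. exp (\<i> * of_real (\<theta> t))) has_vector_derivative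
      of_real \<theta>' * (\<i> * exp (\<i> * of_real (\<theta> t)))) (at t)"
    by (simp add: o_def)
  have "of_real (\<rho> t) * (of_real \<theta>' * (\<i> * exp (\<i> * of_real (\<theta> t)))) + of_real \<rho>' * exp (\<i> * of_real (\<theta> t))
      = cis (\<theta> t) * Complex \<rho>' (\<rho> t * \<theta>')"
    by (simp add: cis_conv_exp[symmetric] Complex_eq algebra_simps)
  thus ?thesis using has_vector_derivative_mult[OF 1 3] by simp
qed

text \<open>The reduced dynamics after the near-resonances have been turned into relations between indices. The
relation \<open>\<kappa> / \<kappa>\<^sub>0 = 1 - m\<^sub>1 + m\<^sub>2\<close> is the reason why \<open>\<theta>\<close> and \<open>\<phi>\<close> enter the polar equations only through
\<open>\<psi> = \<theta> - \<kappa>\<^sub>0 \<phi>\<close>.\<close>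

locale resonant_reduced_dynamics =
  fixes R :: "nat \<times> nat \<Rightarrow> complex" and S :: "nat \<times> nat \<Rightarrow> int \<Rightarrow> complex"
    and \<kappa>\<^sub>0 :: int and r :: real
  assumes converge: "coeffs_converge r R S"
    and \<kappa>\<^sub>0: "\<kappa>\<^sub>0 \<noteq> 0"
    and autonomous_resonance: "R m \<noteq> 0 \<Longrightarrow> fst m = Suc (snd m)"
    and forced_resonance:
      "\<kappa> \<noteq> 0 \<Longrightarrow> S m \<kappa> \<noteq> 0 \<Longrightarrow> \<kappa> = \<kappa>\<^sub>0 * (1 - int (fst m) + int (snd m))"
begin

definition ratio :: "int \<Rightarrow> real" where
  "ratio \<kappa> = of_int \<kappa> / of_int \<kappa>\<^sub>0"

lemma ratio_resonant: "\<kappa> \<noteq> 0 \<Longrightarrow> S m \<kappa> \<noteq> 0 \<Longrightarrow> ratio \<kappa> = 1 - real (fst m) + real (snd m)"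
  using forced_resonance[of \<kappa> m] \<kappa>\<^sub>0 by (simp add: ratio_def)

definition radial :: "real \<Rightarrow> complex" where
  "radial \<rho> = (\<Sum>\<^sub>\<infinity>m\<in>UNIV. R m * of_real (\<rho> ^ msize m))"

definition forced :: "real \<Rightarrow> real \<Rightarrow> complex" where
  "forced \<rho> \<psi> = (\<Sum>\<^sub>\<infinity>(m, \<kappa>)\<in>UNIV \<times> (- {0}).
     S m \<kappa> * of_real (\<rho> ^ msize m) * cis (- (ratio \<kappa> * \<psi>)))"

lemma R_conv: "0 \<le> \<rho> \<Longrightarrow> \<rho> < r \<Longrightarrow> (\<lambda>m. cmod (R m) * \<rho> ^ msize m) summable_on UNIV"
  using converge by (simp add: coeffs_converge_def)

lemma S_conv: "0 \<le> \<rho> \<Longrightarrow> \<rho> < r \<Longrightarrow>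
    (\<lambda>i. cmod (S (fst i) (snd i)) * \<rho> ^ msize (fst i)) summable_on (UNIV \<times> (- {0}))"
  using converge by (simp add: coeffs_converge_def case_prod_unfold)

lemma radial_summable: "0 \<le> \<rho> \<Longrightarrow> \<rho> < r \<Longrightarrow> (\<lambda>m. R m * of_real (\<rho> ^ msize m)) summable_on UNIV"
  by (rule summable_on_norm_bound(1)[OF R_conv[of \<rho>]]) (auto simp: norm_mult norm_power)

lemma forced_summable:
  assumes "0 \<le> \<rho>" "\<rho> < r"
  shows "(\<lambda>i. S (fst i) (snd i) * of_real (\<rho> ^ msize (fst i)) * cis (- (ratio (snd i) * \<psi>)))
           summable_on (UNIV \<times> (- {0}))"
  by (rule summable_on_norm_bound(1)[OF S_conv[OF assms]])
     (use assms in \<open>auto simp: norm_mult norm_power\<close>)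

text \<open>At order \<open>m = 0\<close> the resonance relation leaves the single harmonic \<open>\<kappa>\<^sub>0\<close>. This separates the leading
forcing term from the sum over \<open>m \<noteq> 0\<close>, both in the polar field and in its Jacobian.\<close>

lemma infsum_split_resonant_harmonic:
  fixes h :: "(nat \<times> nat) \<times> int \<Rightarrow> 'b::banach"
  assumes "h summable_on (UNIV \<times> (- {0}))" "\<And>\<kappa>. S (0, 0) \<kappa> = 0 \<Longrightarrow> h ((0, 0), \<kappa>) = 0"
  shows "infsum h (UNIV \<times> (- {0})) = h ((0, 0), \<kappa>\<^sub>0) + infsum h ((- {(0, 0)}) \<times> (- {0}))"
proof -
  have "infsum h (UNIV \<times> (- {0})) = infsum h ({(0, 0)} \<times> (- {0}) \<union> (- {(0, 0)}) \<times> (- {0}))"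
    by (rule arg_cong[where f = "infsum h"]) auto
  also have "\<dots> = infsum h ({(0, 0)} \<times> (- {0})) + infsum h ((- {(0, 0)}) \<times> (- {0}))"
    by (rule infsum_Un_disjoint) (use assms(1) in \<open>auto elim!: summable_on_subset_banach\<close>)
  also have "infsum h ({(0, 0)} \<times> (- {0})) = infsum h {((0, 0), \<kappa>\<^sub>0)}"
  proof (rule infsum_cong_neutral)
    fix i :: "(nat \<times> nat) \<times> int" assume i: "i \<in> {(0, 0)} \<times> (- {0}) - {((0, 0), \<kappa>\<^sub>0)}"
    hence "S (0, 0) (snd i) = 0" using forced_resonance[of "snd i" "(0, 0)"] by auto
    thus "h i = 0" using assms(2)[of "snd i"] i by auto
  qed (use \<kappa>\<^sub>0 in auto)
  finally show ?thesis by simp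
qed

text \<open>A monomial of index \<open>m\<close> rotates with angle \<open>(m\<^sub>1 - m\<^sub>2) \<theta>\<close>. After division by \<open>cis \<theta>\<close> the resonant
autonomous terms do not depend on \<open>\<theta>\<close>, and a resonant forced term has phase
\<open>\<kappa> \<phi> + (m\<^sub>1 - m\<^sub>2 - 1) \<theta> = - (\<kappa> / \<kappa>\<^sub>0) (\<theta> - \<kappa>\<^sub>0 \<phi>)\<close>.\<close>

lemma reduced_dynamics_rotated:
  "R_series R (of_real \<rho> * exp (\<i> * of_real \<theta>)) +
     of_real \<epsilon> * S_series S (of_real \<rho> * exp (\<i> * of_real \<theta>)) \<phi> =
   cis \<theta> * (radial \<rho> + of_real \<epsilon> * forced \<rho> (\<theta> - of_int \<kappa>\<^sub>0 * \<phi>))"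
proof -
  define p where "p = of_real \<rho> * exp (\<i> * of_real \<theta>)"
  have p: "p = of_real \<rho> * cis \<theta>" by (simp add: p_def cis_conv_exp)
  have pow: "p ^ a * cnj p ^ b = of_real (\<rho> ^ (a + b)) * cis ((real a - real b) * \<theta>)" for a b
  proof -
    have "p ^ a * cnj p ^ b = of_real (\<rho> ^ (a + b)) * (cis (real a * \<theta>) * cis (real b * - \<theta>))"
      by (simp add: p power_mult_distrib cis_cnj power_add Complex.DeMoivre)
    thus ?thesis by (simp add: cis_mult algebra_simps)
  qed
  have autonomous: "R_series R p = cis \<theta> * radial \<rho>"
    unfolding R_series_def radial_def infsum_cmult_right'[symmetric]
  proof (rule infsum_cong)
    fix m
    show "R m * p ^ fst m * cnj p ^ snd m = cis \<theta> * (R m * of_real (\<rho> ^ msize m))"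
      using autonomous_resonance[of m] pow[of "fst m" "snd m"]
      by (cases "R m = 0") (simp_all add: msize_def mult.assoc)
  qed
  have forced_term: "S m \<kappa> * exp (\<i> * of_int \<kappa> * of_real \<phi>) * p ^ fst m * cnj p ^ snd m =
      cis \<theta> * (S m \<kappa> * of_real (\<rho> ^ msize m) * cis (- (ratio \<kappa> * (\<theta> - of_int \<kappa>\<^sub>0 * \<phi>))))"
    if "\<kappa> \<noteq> 0" for m \<kappa>
  proof (cases "S m \<kappa> = 0")
    case False
    have rat: "ratio \<kappa> = 1 - real (fst m) + real (snd m)" by (rule ratio_resonant[OF that False])
    have \<kappa>: "real_of_int \<kappa> = ratio \<kappa> * of_int \<kappa>\<^sub>0" using \<kappa>\<^sub>0 by (simp add: ratio_def)
    have "exp (\<i> * of_int \<kappa> * of_real \<phi>) = cis (of_int \<kappa> * \<phi>)"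
      by (simp add: cis_conv_exp mult.assoc)
    hence "S m \<kappa> * exp (\<i> * of_int \<kappa> * of_real \<phi>) * p ^ fst m * cnj p ^ snd m =
        S m \<kappa> * cis (of_int \<kappa> * \<phi>) * (p ^ fst m * cnj p ^ snd m)"
      by (simp only: mult.assoc)
    also have "\<dots> = S m \<kappa> * of_real (\<rho> ^ (fst m + snd m)) *
        (cis (of_int \<kappa> * \<phi>) * cis ((real (fst m) - real (snd m)) * \<theta>))"
      unfolding pow by (simp only: mult_ac)
    also have "cis (of_int \<kappa> * \<phi>) * cis ((real (fst m) - real (snd m)) * \<theta>) =
        cis \<theta> * cis (- (ratio \<kappa> * (\<theta> - of_int \<kappa>\<^sub>0 * \<phi>)))"
      unfolding cis_mult \<kappa> rat by (rule arg_cong[where f = cis]) (simp add: algebra_simps)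
    finally show ?thesis by (simp only: msize_def mult_ac)
  qed simp
  have "S_series S p \<phi> = cis \<theta> * forced \<rho> (\<theta> - of_int \<kappa>\<^sub>0 * \<phi>)"
    unfolding S_series_def forced_def case_prod_unfold infsum_cmult_right'[symmetric]
    by (rule infsum_cong, rule forced_term) auto
  with autonomous show ?thesis by (simp add: p_def algebra_simps)
qed

text \<open>The complex number \<open>\<rho>' + i \<rho> \<psi>'\<close>.\<close>

definition polar_velocity :: "real \<Rightarrow> real \<Rightarrow> real \<Rightarrow> real \<Rightarrow> complex" where
  "polar_velocity \<epsilon> \<Omega> \<rho> \<psi> =
     radial \<rho> - \<i> * of_real (of_int \<kappa>\<^sub>0 * \<rho> * \<Omega>) + of_real \<epsilon> * forced \<rho> \<psi>"

text \<open>The rotation \<open>Q \<alpha>\<close> is multiplication by \<open>cis (- \<alpha>)\<close> when the plane is identified with the complex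
numbers; this identification is bounded linear and so passes through the infinite sum.\<close>

lemma polar_r_eq_velocity:
  assumes "0 \<le> \<rho>" "\<rho> < r"
  shows "polar_r \<kappa>\<^sub>0 R S \<epsilon> \<rho> \<psi> \<Omega> =
    vector [Re (polar_velocity \<epsilon> \<Omega> \<rho> \<psi>), Im (polar_velocity \<epsilon> \<Omega> \<rho> \<psi>)]"
proof -
  define K where "K z = (vector [Re z, Im z] :: real^2)" for z
  have K: "bounded_linear K"
    unfolding K_def by (intro bounded_linear_vector_2 bounded_linear_Re bounded_linear_Im)
  have Q: "Q \<alpha> *v vector [Re z, Im z] = K (z * cis (- \<alpha>))" for \<alpha> z
    by (simp add: Q_def K_def vec_eq_iff forall_2 matrix_vector_mult_def sum_2)
  define h where "h i = S (fst i) (snd i) * of_real (\<rho> ^ msize (fst i)) * cis (- (ratio (snd i) * \<psi>))"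
    for i
  have h: "h summable_on (UNIV \<times> (- {0}))" unfolding h_def by (rule forced_summable[OF assms])
  have "forced \<rho> \<psi> = infsum h (UNIV \<times> (- {0}))"
    unfolding forced_def h_def by (simp add: case_prod_unfold)
  also have "\<dots> = h ((0, 0), \<kappa>\<^sub>0) + infsum h ((- {(0, 0)}) \<times> (- {0}))"
    by (rule infsum_split_resonant_harmonic[OF h]) (simp add: h_def)
  finally have forced: "forced \<rho> \<psi> = S (0, 0) \<kappa>\<^sub>0 * cis (- \<psi>) + infsum h ((- {(0, 0)}) \<times> (- {0}))"
    using \<kappa>\<^sub>0 by (simp add: h_def msize_def ratio_def)
  have "h summable_on ((- {(0, 0)}) \<times> (- {0}))"
    using h by (rule summable_on_subset_banach) auto
  from infsumI[OF has_sum_bounded_linear[OF K has_sum_infsum[OF this]]]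
  have "(\<Sum>\<^sub>\<infinity>i\<in>(- {(0, 0)}) \<times> (- {0}). K (h i)) = K (infsum h ((- {(0, 0)}) \<times> (- {0})))"
    by (simp add: o_def)
  moreover have "K (h i) = \<rho> ^ msize (fst i) *\<^sub>R
      (Q (of_int (snd i) / of_int \<kappa>\<^sub>0 * \<psi>) *v vector [Re (S (fst i) (snd i)), Im (S (fst i) (snd i))])" for i
    unfolding Q linear_scale[OF bounded_linear.linear[OF K], symmetric]
    by (simp add: h_def ratio_def scaleR_conv_of_real mult_ac)
  ultimately have "(\<Sum>\<^sub>\<infinity>(m, \<kappa>)\<in>(- {(0, 0)}) \<times> (- {0}). \<rho> ^ msize m *\<^sub>R
      (Q (of_int \<kappa> / of_int \<kappa>\<^sub>0 * \<psi>) *v vector [Re (S m \<kappa>), Im (S m \<kappa>)])) =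
      K (infsum h ((- {(0, 0)}) \<times> (- {0})))"
    by (simp add: case_prod_unfold)
  thus ?thesis
    unfolding polar_r_def polar_a_def polar_b_def radial_def[symmetric] Q polar_velocity_def forced
    by (simp add: K_def vec_eq_iff forall_2 algebra_simps)
qed

text \<open>Since \<open>p' = cis \<theta> (\<rho>' + i \<rho> \<theta>')\<close>, dividing both sides of the reduced equation by \<open>cis \<theta>\<close> gives the
polar equations as real and imaginary parts. The division is by a number of modulus one, so the
equivalence also holds at \<open>\<rho> = 0\<close>. The shift \<open>- \<kappa>\<^sub>0 \<rho> \<Omega>\<close> comes from \<open>\<psi>' = \<theta>' - \<kappa>\<^sub>0 \<Omega>\<close>.\<close>

lemma reduced_iff_polar_solution:
  assumes T: "open T" "\<And>t. t \<in> T \<Longrightarrow>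
      0 \<le> \<rho> t \<and> \<rho> t < r \<and> \<rho> differentiable (at t) \<and> \<theta> differentiable (at t)"
  shows "reduced_solution R S \<epsilon> \<Omega> T (\<lambda>t. of_real (\<rho> t) * exp (\<i> * of_real (\<theta> t))) \<phi> \<longleftrightarrow>
     polar_solution \<kappa>\<^sub>0 R S \<epsilon> \<Omega> T \<rho> (\<lambda>t. \<theta> t - of_int \<kappa>\<^sub>0 * \<phi> t) \<and>
     (\<forall>t\<in>T. (\<phi> has_real_derivative \<Omega>) (at t within T))"
proof -
  define p where "p t = complex_of_real (\<rho> t) * exp (\<i> * of_real (\<theta> t))" for t
  have pointwise: "(p has_vector_derivative (R_series R (p t) + of_real \<epsilon> * S_series S (p t) (\<phi> t))) (at t) \<longleftrightarrow>
      (\<exists>\<rho>' \<psi>'. (\<rho> has_real_derivative \<rho>') (at t) \<and>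
        ((\<lambda>t. \<theta> t - of_int \<kappa>\<^sub>0 * \<phi> t) has_real_derivative \<psi>') (at t) \<and>
        vector [\<rho>', \<rho> t * \<psi>'] = polar_r \<kappa>\<^sub>0 R S \<epsilon> (\<rho> t) (\<theta> t - of_int \<kappa>\<^sub>0 * \<phi> t) \<Omega>)"
    if t: "t \<in> T" and \<phi>: "(\<phi> has_real_derivative \<Omega>) (at t)" for t
  proof -
    obtain \<rho>' \<theta>' where d: "(\<rho> has_real_derivative \<rho>') (at t)" "(\<theta> has_real_derivative \<theta>') (at t)"
      using T(2)[OF t] by (auto simp: real_differentiable_def)
    define \<psi> where "\<psi> = \<theta> t - of_int \<kappa>\<^sub>0 * \<phi> t"
    have d\<psi>: "((\<lambda>t. \<theta> t - of_int \<kappa>\<^sub>0 * \<phi> t) has_real_derivative \<theta>' - of_int \<kappa>\<^sub>0 * \<Omega>) (at t)"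
      using d(2) \<phi> by (auto intro!: derivative_eq_intros)
    have dp: "(p has_vector_derivative cis (\<theta> t) * Complex \<rho>' (\<rho> t * \<theta>')) (at t)"
      unfolding p_def by (rule polar_curve_velocity[OF d])
    have rot: "R_series R (p t) + of_real \<epsilon> * S_series S (p t) (\<phi> t) =
        cis (\<theta> t) * (radial (\<rho> t) + of_real \<epsilon> * forced (\<rho> t) \<psi>)"
      unfolding p_def \<psi>_def by (rule reduced_dynamics_rotated)
    have "(p has_vector_derivative (R_series R (p t) + of_real \<epsilon> * S_series S (p t) (\<phi> t))) (at t) \<longleftrightarrow>
        cis (\<theta> t) * Complex \<rho>' (\<rho> t * \<theta>') = R_series R (p t) + of_real \<epsilon> * S_series S (p t) (\<phi> t)"
      using dp vector_derivative_unique_at by metis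
    also have "\<dots> \<longleftrightarrow> Complex \<rho>' (\<rho> t * \<theta>') = radial (\<rho> t) + of_real \<epsilon> * forced (\<rho> t) \<psi>"
      unfolding rot by simp
    also have "\<dots> \<longleftrightarrow> vector [\<rho>', \<rho> t * (\<theta>' - of_int \<kappa>\<^sub>0 * \<Omega>)] = polar_r \<kappa>\<^sub>0 R S \<epsilon> (\<rho> t) \<psi> \<Omega>"
      using T(2)[OF t]
      by (simp add: polar_r_eq_velocity polar_velocity_def vec_eq_iff forall_2 complex_eq_iff algebra_simps)
    also have "\<dots> \<longleftrightarrow> (\<exists>\<rho>' \<psi>'. (\<rho> has_real_derivative \<rho>') (at t) \<and>
        ((\<lambda>t. \<theta> t - of_int \<kappa>\<^sub>0 * \<phi> t) has_real_derivative \<psi>') (at t) \<and>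
        vector [\<rho>', \<rho> t * \<psi>'] = polar_r \<kappa>\<^sub>0 R S \<epsilon> (\<rho> t) \<psi> \<Omega>)"
      using d(1) d\<psi> DERIV_unique by blast
    finally show ?thesis by (simp add: \<psi>_def)
  qed
  show ?thesis
    unfolding reduced_solution_def polar_solution_def p_def[symmetric, abs_def] p_def[symmetric]
    using pointwise by (auto simp: at_within_open[OF _ T(1)])
qed

lemma polar_fixed_point_iff:
  "polar_fixed_point \<kappa>\<^sub>0 R S \<epsilon> \<Omega> \<rho> \<psi> \<longleftrightarrow> polar_r \<kappa>\<^sub>0 R S \<epsilon> \<rho> \<psi> \<Omega> = 0"
proof -
  have "polar_fixed_point \<kappa>\<^sub>0 R S \<epsilon> \<Omega> \<rho> \<psi> \<longleftrightarrow> vector [0, \<rho> * 0] = polar_r \<kappa>\<^sub>0 R S \<epsilon> \<rho> \<psi> \<Omega>"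
    unfolding polar_fixed_point_def polar_solution_def
    using DERIV_const DERIV_unique by (metis UNIV_I)
  moreover have "vector [0, \<rho> * 0] = (0 :: real^2)" by (simp add: vec_eq_iff forall_2)
  ultimately show ?thesis by auto
qed

definition autonomous_field :: "real^2 \<Rightarrow> real^2" where
  "autonomous_field x = (\<Sum>\<^sub>\<infinity>m\<in>UNIV. mode_term (R m) (msize m) 0 x)"

definition forced_field :: "real^2 \<Rightarrow> real^2" where
  "forced_field x = (\<Sum>\<^sub>\<infinity>i\<in>UNIV \<times> (- {0}).
     mode_term (S (fst i) (snd i)) (msize (fst i)) (ratio (snd i)) x)"

definition autonomous_jacobian :: "real^2 \<Rightarrow> real^2^2" where
  "autonomous_jacobian x = (\<Sum>\<^sub>\<infinity>m\<in>UNIV. mode_jacobian (R m) (msize m) 0 x)"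

definition forced_jacobian :: "real^2 \<Rightarrow> real^2^2" where
  "forced_jacobian x = (\<Sum>\<^sub>\<infinity>i\<in>UNIV \<times> (- {0}).
     mode_jacobian (S (fst i) (snd i)) (msize (fst i)) (ratio (snd i)) x)"

lemma autonomous_series:
  assumes "0 < a" "a < b" "b < r"
  shows "\<exists>B. \<forall>x. a < x $ 1 \<and> x $ 1 < b \<longrightarrow>
      (\<lambda>m. mode_jacobian (R m) (msize m) 0 x) summable_on UNIV \<and>
      (autonomous_field has_derivative (*v) (autonomous_jacobian x)) (at x) \<and>
      (\<forall>h. norm (autonomous_jacobian x *v h) \<le> B * norm h)"
proof -
  have "\<bar>0 :: real\<bar> \<le> real (msize m) + 1" for m by simp
  from mode_series[of r R msize UNIV "\<lambda>_. 0" a b, OF R_conv this assms]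
  show ?thesis unfolding autonomous_field_def[abs_def] autonomous_jacobian_def .
qed

text \<open>The resonance relation bounds the frequency ratios by \<open>|m| + 1\<close>, as termwise
differentiation in \<open>\<psi>\<close> requires.\<close>

lemma forced_series:
  assumes "0 < a" "a < b" "b < r"
  shows "\<exists>B. \<forall>x. a < x $ 1 \<and> x $ 1 < b \<longrightarrow>
      (\<lambda>i. mode_jacobian (S (fst i) (snd i)) (msize (fst i)) (ratio (snd i)) x)
        summable_on (UNIV \<times> (- {0})) \<and>
      (forced_field has_derivative (*v) (forced_jacobian x)) (at x) \<and>
      (\<forall>h. norm (forced_jacobian x *v h) \<le> B * norm h)"
proof -
  have "\<bar>ratio (snd i)\<bar> \<le> real (msize (fst i)) + 1"
    if "i \<in> UNIV \<times> (- {0})" "S (fst i) (snd i) \<noteq> 0" for i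
  proof -
    have "ratio (snd i) = 1 - real (fst (fst i)) + real (snd (fst i))"
      by (rule ratio_resonant) (use that in auto)
    thus ?thesis by (simp add: msize_def abs_le_iff)
  qed
  from mode_series[of r "\<lambda>i. S (fst i) (snd i)" "\<lambda>i. msize (fst i)" "UNIV \<times> (- {0})"
      "\<lambda>i. ratio (snd i)" a b, OF S_conv this assms]
  show ?thesis unfolding forced_field_def[abs_def] forced_jacobian_def .
qed

lemma polar_field_eq_series:
  assumes x: "0 < x $ 1" "x $ 1 < r"
  shows "polar_field \<kappa>\<^sub>0 R S \<epsilon> \<Omega> x =
    autonomous_field x + vector [0, - of_int \<kappa>\<^sub>0 * \<Omega>] + \<epsilon> *\<^sub>R forced_field x"
proof -
  define K where "K z = (vector [Re z, Im z / x $ 1] :: real^2)" for z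
  have K: "bounded_linear K"
    unfolding K_def
    by (intro bounded_linear_vector_2 bounded_linear_Re
        bounded_linear_compose[OF bounded_linear_divide bounded_linear_Im])
  have K_scale: "K (of_real t * z) = vector [Re z * t, Im z * (t / x $ 1)]" for t z
    by (simp add: K_def mult.commute)
  have mode: "mode_term c n \<alpha> x = K (c * of_real (x $ 1 ^ n) * cis (- (\<alpha> * x $ 2)))" for c n \<alpha>
  proof -
    have "x $ 1 powi (int n - 1) = x $ 1 ^ n / x $ 1" using x by (simp add: power_int_diff)
    hence "mode_term c n \<alpha> x = K (of_real (x $ 1 ^ n) * (c * cis (- (\<alpha> * x $ 2))))"
      unfolding K_scale by (simp only: mode_term_def power_int_of_nat)
    thus ?thesis by (simp only: mult_ac)
  qed
  have aut: "autonomous_field x = K (radial (x $ 1))"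
    using infsumI[OF has_sum_bounded_linear[OF K has_sum_infsum[OF radial_summable[of "x $ 1"]]]] x
    by (simp add: autonomous_field_def mode radial_def o_def)
  have frc: "forced_field x = K (forced (x $ 1) (x $ 2))"
    using infsumI[OF has_sum_bounded_linear[OF K has_sum_infsum[OF forced_summable[of "x $ 1" "x $ 2"]]]] x
    by (simp add: forced_field_def mode forced_def o_def case_prod_unfold)
  show ?thesis
    unfolding polar_field_def aut frc using x
    by (simp add: polar_r_eq_velocity polar_velocity_def K_def vec_eq_iff forall_2 field_simps)
qed

text \<open>The forced part of \<open>polar_J\<close> is the sum of the termwise Jacobians, with the only term of order
\<open>m = 0\<close> written separately. Its autonomous part is
given by derivatives of \<open>polar_a\<close> and \<open>polar_b / \<rho>\<close> instead; these are identified with the first column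
of the summed Jacobian by restricting the autonomous field to a line of constant \<open>\<psi>\<close>, and the second
column vanishes because autonomous terms have frequency zero.\<close>

lemma polar_J_eq_series:
  assumes x: "0 < x $ 1" "x $ 1 < r"
  shows "polar_J \<kappa>\<^sub>0 R S \<epsilon> \<Omega> (x $ 1) (x $ 2) = autonomous_jacobian x + \<epsilon> *\<^sub>R forced_jacobian x"
proof -
  define \<rho> \<psi> where "\<rho> = x $ 1" and "\<psi> = x $ 2"
  have \<rho>: "0 < \<rho>" "\<rho> < r" using x by (auto simp: \<rho>_def)
  have ab: "0 < \<rho> / 2" "\<rho> / 2 < (\<rho> + r) / 2" "(\<rho> + r) / 2 < r" "\<rho> / 2 < x $ 1" "x $ 1 < (\<rho> + r) / 2"
    using \<rho> by (auto simp: \<rho>_def[symmetric])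

  have aut: "(\<lambda>m. mode_jacobian (R m) (msize m) 0 x) summable_on UNIV"
    "(autonomous_field has_derivative (*v) (autonomous_jacobian x)) (at x)"
    using autonomous_series[OF ab(1-3)] ab(4,5) by blast+
  have frc: "(\<lambda>i. mode_jacobian (S (fst i) (snd i)) (msize (fst i)) (ratio (snd i)) x)
      summable_on (UNIV \<times> (- {0}))"
    using forced_series[OF ab(1-3)] ab(4,5) by blast

  have entry: "bounded_linear (\<lambda>A :: real^2^2. A $ i $ j)" for i j
    by (intro bounded_linear_compose[OF bounded_linear_vec_nth bounded_linear_vec_nth])
  have col2: "autonomous_jacobian x $ i $ 2 = 0" for i
  proof -
    have "autonomous_jacobian x $ i $ 2 = (\<Sum>\<^sub>\<infinity>m\<in>UNIV. mode_jacobian (R m) (msize m) 0 x $ i $ 2)"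
      using infsumI[OF has_sum_bounded_linear[OF entry has_sum_infsum[OF aut(1)]], of i 2]
      by (simp add: autonomous_jacobian_def o_def)
    moreover have "mode_jacobian (R m) (msize m) 0 x $ i $ 2 = 0" for m
      using exhaust_2[of i] by (auto simp: mode_jacobian_def Let_def)
    ultimately show ?thesis by simp
  qed
  have line: "((\<lambda>s. vector [s, \<psi>] :: real^2) has_derivative (\<lambda>h. vector [h, 0])) (at \<rho>)"
    by (intro has_derivative_vector_2 has_derivative_ident has_derivative_const)
  have x_eq: "x = vector [\<rho>, \<psi>]" by (simp add: \<rho>_def \<psi>_def vec_eq_iff forall_2)
  have along: "((\<lambda>s. autonomous_field (vector [s, \<psi>]) $ i) has_real_derivative
      autonomous_jacobian x $ i $ 1) (at \<rho>)" for i
  proof -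
    have "((\<lambda>s. autonomous_field (vector [s, \<psi>])) has_derivative
        (\<lambda>h. autonomous_jacobian x *v vector [h, 0])) (at \<rho>)"
      using has_derivative_compose[OF line] aut(2) unfolding x_eq by blast
    from bounded_linear.has_derivative[OF bounded_linear_vec_nth this, of i]
    show ?thesis
      by (simp add: has_field_derivative_def matrix_vector_mult_def sum_2 mult.commute[of _ "autonomous_jacobian x $ i $ 1"])
  qed
  \<comment> \<open>The case \<open>\<epsilon> = 0\<close> of the series for the polar field, with the constant drift removed.\<close>
  have field: "autonomous_field (vector [s, \<psi>]) =
      vector [polar_a R s, polar_b \<kappa>\<^sub>0 R s \<Omega> / s + of_int \<kappa>\<^sub>0 * \<Omega>]" if "s \<in> {0<..<r}" for s
  proof -
    have "autonomous_field (vector [s, \<psi>]) + vector [0, - of_int \<kappa>\<^sub>0 * \<Omega>] =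
        polar_field \<kappa>\<^sub>0 R S 0 \<Omega> (vector [s, \<psi>])"
      using polar_field_eq_series[of "vector [s, \<psi>]" 0 \<Omega>] that by simp
    also have "\<dots> = vector [polar_a R s, polar_b \<kappa>\<^sub>0 R s \<Omega> / s]"
      by (simp add: polar_field_def polar_r_def)
    finally show ?thesis by (simp add: vec_eq_iff forall_2 algebra_simps)
  qed
  have open_interval: "open {0<..<r}" "\<rho> \<in> {0<..<r}" using \<rho> by auto
  have "(polar_a R has_real_derivative autonomous_jacobian x $ 1 $ 1) (at \<rho>)"
    by (rule has_field_derivative_transform_within_open[OF along open_interval]) (simp add: field)
  hence a: "deriv (polar_a R) \<rho> = autonomous_jacobian x $ 1 $ 1" by (rule DERIV_imp_deriv)
  have "((\<lambda>s. autonomous_field (vector [s, \<psi>]) $ 2 - of_int \<kappa>\<^sub>0 * \<Omega>) has_real_derivative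
      autonomous_jacobian x $ 2 $ 1) (at \<rho>)"
    using DERIV_diff[OF along[of 2] DERIV_const[of "of_int \<kappa>\<^sub>0 * \<Omega>"]] by simp
  hence "((\<lambda>s. polar_b \<kappa>\<^sub>0 R s \<Omega> / s) has_real_derivative autonomous_jacobian x $ 2 $ 1) (at \<rho>)"
    by (rule has_field_derivative_transform_within_open[OF _ open_interval]) (simp add: field)
  hence b: "deriv (\<lambda>s. polar_b \<kappa>\<^sub>0 R s \<Omega> / s) \<rho> = autonomous_jacobian x $ 2 $ 1" by (rule DERIV_imp_deriv)
  have "autonomous_jacobian x =
      vector [vector [deriv (polar_a R) \<rho>, 0], vector [deriv (\<lambda>s. polar_b \<kappa>\<^sub>0 R s \<Omega> / s) \<rho>, 0]]"
    by (simp add: a b vec_eq_iff forall_2 col2)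
  moreover

  define h where "h i = mode_jacobian (S (fst i) (snd i)) (msize (fst i)) (ratio (snd i)) x" for i
  have cd: "polar_c \<kappa>\<^sub>0 S m \<kappa> \<psi> = Re (S m \<kappa> * cis (- (ratio \<kappa> * \<psi>)))"
    "polar_d \<kappa>\<^sub>0 S m \<kappa> \<psi> = Im (S m \<kappa> * cis (- (ratio \<kappa> * \<psi>)))" for m \<kappa>
    by (simp_all add: polar_c_def polar_d_def ratio_def)
  have h: "h = (\<lambda>(m, \<kappa>).
      vector [vector [polar_c \<kappa>\<^sub>0 S m \<kappa> \<psi> * real (msize m) * \<rho> powi (int (msize m) - 1),
                      of_int \<kappa> / of_int \<kappa>\<^sub>0 * polar_d \<kappa>\<^sub>0 S m \<kappa> \<psi> * \<rho> ^ msize m],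
              vector [polar_d \<kappa>\<^sub>0 S m \<kappa> \<psi> * (real (msize m) - 1) * \<rho> powi (int (msize m) - 2),
                      - (of_int \<kappa> / of_int \<kappa>\<^sub>0 * polar_c \<kappa>\<^sub>0 S m \<kappa> \<psi> * \<rho> powi (int (msize m) - 1))]])"
    by (rule ext) (simp only: h_def mode_jacobian_def Let_def cd \<rho>_def[symmetric] \<psi>_def[symmetric]
        case_prod_unfold ratio_def power_int_of_nat)
  have "forced_jacobian x = h ((0, 0), \<kappa>\<^sub>0) + infsum h ((- {(0, 0)}) \<times> (- {0}))"
    unfolding forced_jacobian_def h_def[symmetric]
  proof (rule infsum_split_resonant_harmonic)
    show "h summable_on (UNIV \<times> (- {0}))" unfolding h_def by (rule frc)
    show "h ((0, 0), \<kappa>) = 0" if "S (0, 0) \<kappa> = 0" for \<kappa>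
      using that by (simp add: h polar_c_def polar_d_def vec_eq_iff forall_2)
  qed
  moreover have "h ((0, 0), \<kappa>\<^sub>0) = vector [vector [0, polar_d \<kappa>\<^sub>0 S (0, 0) \<kappa>\<^sub>0 \<psi>],
      vector [- (polar_d \<kappa>\<^sub>0 S (0, 0) \<kappa>\<^sub>0 \<psi> / \<rho>\<^sup>2), - (polar_c \<kappa>\<^sub>0 S (0, 0) \<kappa>\<^sub>0 \<psi> / \<rho>)]]"
    using \<kappa>\<^sub>0 by (simp add: h msize_def power_int_minus divide_inverse)
  ultimately show ?thesis
    unfolding polar_J_def \<rho>_def[symmetric] \<psi>_def[symmetric] h[symmetric] by simp
qed

text \<open>The constant \<open>B\<close> does not depend on the point, so the polar field is Lipschitz on balls inside the
annulus; this gives the solutions needed to refute stability.\<close>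

lemma polar_field_derivative:
  assumes "0 < a" "a < b" "b < r"
  obtains B where "\<And>x. a < x $ 1 \<Longrightarrow> x $ 1 < b \<Longrightarrow>
      (polar_field \<kappa>\<^sub>0 R S \<epsilon> \<Omega> has_derivative (*v) (polar_J \<kappa>\<^sub>0 R S \<epsilon> \<Omega> (x $ 1) (x $ 2))) (at x) \<and>
      (\<forall>h. norm (polar_J \<kappa>\<^sub>0 R S \<epsilon> \<Omega> (x $ 1) (x $ 2) *v h) \<le> B * norm h)"
proof -
  obtain B\<^sub>1 where B\<^sub>1: "\<And>x. a < x $ 1 \<Longrightarrow> x $ 1 < b \<Longrightarrow>
      (autonomous_field has_derivative (*v) (autonomous_jacobian x)) (at x) \<and>
      (\<forall>h. norm (autonomous_jacobian x *v h) \<le> B\<^sub>1 * norm h)"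
    using autonomous_series[OF assms] by blast
  obtain B\<^sub>2 where B\<^sub>2: "\<And>x. a < x $ 1 \<Longrightarrow> x $ 1 < b \<Longrightarrow>
      (forced_field has_derivative (*v) (forced_jacobian x)) (at x) \<and>
      (\<forall>h. norm (forced_jacobian x *v h) \<le> B\<^sub>2 * norm h)"
    using forced_series[OF assms] by blast
  show ?thesis
  proof (rule that[of "B\<^sub>1 + \<bar>\<epsilon>\<bar> * B\<^sub>2"], intro conjI allI)
    fix x :: "real^2" assume x: "a < x $ 1" "x $ 1 < b"
    have x': "0 < x $ 1" "x $ 1 < r" using x assms by auto
    have J: "polar_J \<kappa>\<^sub>0 R S \<epsilon> \<Omega> (x $ 1) (x $ 2) *v h =
        autonomous_jacobian x *v h + \<epsilon> *\<^sub>R (forced_jacobian x *v h)" for h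
      by (simp add: polar_J_eq_series[OF x'] matrix_vector_mult_add_rdistrib scaleR_matrix_vector_assoc)
    have "((\<lambda>x. autonomous_field x + vector [0, - of_int \<kappa>\<^sub>0 * \<Omega>] + \<epsilon> *\<^sub>R forced_field x) has_derivative
        (\<lambda>h. autonomous_jacobian x *v h + 0 + \<epsilon> *\<^sub>R (forced_jacobian x *v h))) (at x)"
      using B\<^sub>1[OF x] B\<^sub>2[OF x]
      by (intro has_derivative_add has_derivative_const has_derivative_scaleR_right) auto
    moreover have "open {x :: real^2. 0 < x $ 1 \<and> x $ 1 < r}"
      by (intro open_Collect_conj open_Collect_less continuous_intros)
    ultimately have "(polar_field \<kappa>\<^sub>0 R S \<epsilon> \<Omega> has_derivative
        (\<lambda>h. autonomous_jacobian x *v h + 0 + \<epsilon> *\<^sub>R (forced_jacobian x *v h))) (at x)"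
      by (rule has_derivative_transform_within_open) (use x' polar_field_eq_series in auto)
    thus "(polar_field \<kappa>\<^sub>0 R S \<epsilon> \<Omega> has_derivative
        (*v) (polar_J \<kappa>\<^sub>0 R S \<epsilon> \<Omega> (x $ 1) (x $ 2))) (at x)"
      by (simp add: J[abs_def])
    fix h
    have "norm (autonomous_jacobian x *v h + \<epsilon> *\<^sub>R (forced_jacobian x *v h)) \<le>
        norm (autonomous_jacobian x *v h) + \<bar>\<epsilon>\<bar> * norm (forced_jacobian x *v h)"
      using norm_triangle_ineq[of "autonomous_jacobian x *v h" "\<epsilon> *\<^sub>R (forced_jacobian x *v h)"] by simp
    also have "\<dots> \<le> B\<^sub>1 * norm h + \<bar>\<epsilon>\<bar> * (B\<^sub>2 * norm h)"
      using B\<^sub>1[OF x] B\<^sub>2[OF x] by (intro add_mono mult_left_mono) auto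
    finally show "norm (polar_J \<kappa>\<^sub>0 R S \<epsilon> \<Omega> (x $ 1) (x $ 2) *v h) \<le> (B\<^sub>1 + \<bar>\<epsilon>\<bar> * B\<^sub>2) * norm h"
      by (simp add: J algebra_simps)
  qed
qed

text \<open>For \<open>\<rho> > 0\<close> the equation for \<open>\<rho> \<psi>'\<close> can be divided by \<open>\<rho>\<close>, so polar solutions are the integral curves
of \<open>polar_field\<close>.\<close>

lemma polar_state_solution_iff:
  "polar_state_solution r \<kappa>\<^sub>0 R S \<epsilon> \<Omega> T x \<longleftrightarrow>
     (\<forall>t\<in>T. 0 < x t $ 1 \<and> x t $ 1 < r \<and>
       (x has_vector_derivative polar_field \<kappa>\<^sub>0 R S \<epsilon> \<Omega> (x t)) (at t within T))"
proof -
  have "(\<exists>\<rho>' \<psi>'. ((\<lambda>t. x t $ 1) has_real_derivative \<rho>') (at t within T) \<and>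
        ((\<lambda>t. x t $ 2) has_real_derivative \<psi>') (at t within T) \<and>
        vector [\<rho>', x t $ 1 * \<psi>'] = polar_r \<kappa>\<^sub>0 R S \<epsilon> (x t $ 1) (x t $ 2) \<Omega>) \<longleftrightarrow>
      (x has_vector_derivative polar_field \<kappa>\<^sub>0 R S \<epsilon> \<Omega> (x t)) (at t within T)" (is "?L \<longleftrightarrow> ?D")
    if pos: "0 < x t $ 1" for t
  proof
    assume ?L
    then obtain \<rho>' \<psi>' where d: "((\<lambda>t. x t $ 1) has_real_derivative \<rho>') (at t within T)"
      "((\<lambda>t. x t $ 2) has_real_derivative \<psi>') (at t within T)"
      and eq: "vector [\<rho>', x t $ 1 * \<psi>'] = polar_r \<kappa>\<^sub>0 R S \<epsilon> (x t $ 1) (x t $ 2) \<Omega>" by blast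
    have "((\<lambda>t. vector [x t $ 1, x t $ 2] :: real^2) has_derivative (\<lambda>h. vector [\<rho>' * h, \<psi>' * h])) (at t within T)"
      using d unfolding has_field_derivative_def by (rule has_derivative_vector_2)
    moreover have "(\<lambda>t. vector [x t $ 1, x t $ 2]) = x" by (simp add: fun_eq_iff vec_eq_iff forall_2)
    moreover have "polar_field \<kappa>\<^sub>0 R S \<epsilon> \<Omega> (x t) = vector [\<rho>', \<psi>']"
      unfolding polar_field_def eq[symmetric] using pos by simp
    hence "(\<lambda>h. vector [\<rho>' * h, \<psi>' * h]) = (\<lambda>h. h *\<^sub>R polar_field \<kappa>\<^sub>0 R S \<epsilon> \<Omega> (x t))"
      by (simp add: fun_eq_iff vec_eq_iff forall_2)
    ultimately show ?D by (simp add: has_vector_derivative_def)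
  next
    assume D: ?D
    have "((\<lambda>t. x t $ i) has_real_derivative polar_field \<kappa>\<^sub>0 R S \<epsilon> \<Omega> (x t) $ i) (at t within T)" for i
      using bounded_linear.has_vector_derivative[OF bounded_linear_vec_nth D, of i]
      by (simp add: has_real_derivative_iff_has_vector_derivative)
    moreover have "vector [polar_field \<kappa>\<^sub>0 R S \<epsilon> \<Omega> (x t) $ 1, x t $ 1 * polar_field \<kappa>\<^sub>0 R S \<epsilon> \<Omega> (x t) $ 2] =
        polar_r \<kappa>\<^sub>0 R S \<epsilon> (x t $ 1) (x t $ 2) \<Omega>"
      using pos by (simp add: polar_field_def vec_eq_iff forall_2)
    ultimately show ?L by blast
  qed
  thus ?thesis unfolding polar_state_solution_def polar_solution_def by blast
qed

lemma polar_stability: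
  assumes \<rho>: "0 < \<rho>" "\<rho> < r" and fixed: "polar_fixed_point \<kappa>\<^sub>0 R S \<epsilon> \<Omega> \<rho> \<psi>"
    and hyp: "hyperbolic_at (polar_field \<kappa>\<^sub>0 R S \<epsilon> \<Omega>) (vector [\<rho>, \<psi>])"
  shows "(asymptotically_stable (polar_state_solution r \<kappa>\<^sub>0 R S \<epsilon> \<Omega>) (vector [\<rho>, \<psi>]) \<longleftrightarrow>
            (\<forall>\<mu>\<in>eigenvalues (polar_J \<kappa>\<^sub>0 R S \<epsilon> \<Omega> \<rho> \<psi>). Re \<mu> < 0)) \<and>
         (\<not> lyapunov_stable (polar_state_solution r \<kappa>\<^sub>0 R S \<epsilon> \<Omega>) (vector [\<rho>, \<psi>]) \<longleftrightarrow>
            (\<exists>\<mu>\<in>eigenvalues (polar_J \<kappa>\<^sub>0 R S \<epsilon> \<Omega> \<rho> \<psi>). 0 < Re \<mu>))"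
proof -
  define F where "F = polar_field \<kappa>\<^sub>0 R S \<epsilon> \<Omega>"
  define x\<^sub>0 :: "real^2" where "x\<^sub>0 = vector [\<rho>, \<psi>]"
  \<comment> \<open>The ball of this radius stays inside the annulus \<open>\<rho> / 2 < x\<^sub>1 < (\<rho> + r) / 2\<close>.\<close>
  define s where "s = min (\<rho> / 4) ((r - \<rho>) / 4)"
  have s: "0 < s" "s \<le> \<rho> / 4" "s \<le> (r - \<rho>) / 4"
    unfolding s_def using \<rho> by (simp_all only: min.cobounded1 min.cobounded2 min_less_iff_conj) simp_all
  have "0 < \<rho> / 2" "\<rho> / 2 < (\<rho> + r) / 2" "(\<rho> + r) / 2 < r" using \<rho> by auto
  from polar_field_derivative[OF this, of \<epsilon> \<Omega>]
  obtain B where B: "\<And>x. \<rho> / 2 < x $ 1 \<Longrightarrow> x $ 1 < (\<rho> + r) / 2 \<Longrightarrow>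
      (F has_derivative (*v) (polar_J \<kappa>\<^sub>0 R S \<epsilon> \<Omega> (x $ 1) (x $ 2))) (at x) \<and>
      (\<forall>h. norm (polar_J \<kappa>\<^sub>0 R S \<epsilon> \<Omega> (x $ 1) (x $ 2) *v h) \<le> B * norm h)"
    unfolding F_def by metis
  have ball: "\<rho> / 2 < x $ 1" "x $ 1 < (\<rho> + r) / 2" if "x \<in> cball x\<^sub>0 s" for x
  proof -
    have "\<bar>(x - x\<^sub>0) $ 1\<bar> \<le> s"
      using component_le_norm_cart[of "x - x\<^sub>0" 1] that by (simp add: dist_norm norm_minus_commute)
    hence "\<bar>x $ 1 - \<rho>\<bar> \<le> s" by (simp add: x\<^sub>0_def)
    thus "\<rho> / 2 < x $ 1" "x $ 1 < (\<rho> + r) / 2" using s \<rho> by (auto simp: abs_le_iff field_simps)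
  qed
  have deriv: "(F has_derivative (*v) (polar_J \<kappa>\<^sub>0 R S \<epsilon> \<Omega> \<rho> \<psi>)) (at x\<^sub>0)"
    using B[OF ball[of x\<^sub>0]] s by (simp add: x\<^sub>0_def)
  hence jac: "jacobian F (at x\<^sub>0) = polar_J \<kappa>\<^sub>0 R S \<epsilon> \<Omega> \<rho> \<psi>"
    unfolding jacobian_def by (metis frechet_derivative_at matrix_of_matrix_vector_mul)
  show ?thesis
    unfolding F_def[symmetric] x\<^sub>0_def[symmetric]
  proof (rule planar_linearized_stability[OF deriv _ s(1)])
    have "polar_r \<kappa>\<^sub>0 R S \<epsilon> \<rho> \<psi> \<Omega> = 0" using fixed polar_fixed_point_iff by blast
    thus "F x\<^sub>0 = 0" by (simp add: F_def polar_field_def x\<^sub>0_def vec_eq_iff forall_2)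
    show "(max B 0)-lipschitz_on (cball x\<^sub>0 s) F"
    proof (rule bounded_derivative_imp_lipschitz)
      fix x assume x: "x \<in> cball x\<^sub>0 s"
      show "(F has_derivative (*v) (polar_J \<kappa>\<^sub>0 R S \<epsilon> \<Omega> (x $ 1) (x $ 2))) (at x within cball x\<^sub>0 s)"
        using B[OF ball[OF x]] has_derivative_at_withinI by blast
      show "onorm ((*v) (polar_J \<kappa>\<^sub>0 R S \<epsilon> \<Omega> (x $ 1) (x $ 2))) \<le> max B 0"
      proof (rule onorm_bound)
        fix h
        have "norm (polar_J \<kappa>\<^sub>0 R S \<epsilon> \<Omega> (x $ 1) (x $ 2) *v h) \<le> B * norm h" using B[OF ball[OF x]] by blast
        also have "\<dots> \<le> max B 0 * norm h" by (intro mult_right_mono) auto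
        finally show "norm (polar_J \<kappa>\<^sub>0 R S \<epsilon> \<Omega> (x $ 1) (x $ 2) *v h) \<le> max B 0 * norm h" .
      qed simp
    qed auto
    show "\<forall>\<mu>\<in>eigenvalues (polar_J \<kappa>\<^sub>0 R S \<epsilon> \<Omega> \<rho> \<psi>). Re \<mu> \<noteq> 0"
      using hyp jac unfolding hyperbolic_at_def F_def x\<^sub>0_def by simp
    show "(x has_vector_derivative F (x t)) (at t within T)"
      if "polar_state_solution r \<kappa>\<^sub>0 R S \<epsilon> \<Omega> T x" "t \<in> T" for T x t
      using that unfolding polar_state_solution_iff F_def by blast
    show "polar_state_solution r \<kappa>\<^sub>0 R S \<epsilon> \<Omega> {0..<\<tau>} x"
      if "\<And>t. t \<in> {0..<\<tau>} \<Longrightarrow> x t \<in> cball x\<^sub>0 s \<and>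
        (x has_vector_derivative F (x t)) (at t within {0..<\<tau>})" for \<tau> x
      unfolding polar_state_solution_iff
    proof (intro ballI)
      fix t assume t: "t \<in> {0..<\<tau>}"
      have "0 < x t $ 1" "x t $ 1 < r" using ball[of "x t"] that[OF t] \<rho> by fastforce+
      thus "0 < x t $ 1 \<and> x t $ 1 < r \<and> (x has_vector_derivative polar_field \<kappa>\<^sub>0 R S \<epsilon> \<Omega> (x t)) (at t within {0..<\<tau>})"
        using that[OF t] by (simp add: F_def)
    qed
  qed
qed

end

theorem lemma5:
  fixes M C K :: "real^'n^'n"
    and f :: "real^'n \<Rightarrow> real^'n \<Rightarrow> real^'n"
    and f_ext :: "real \<Rightarrow> real^'n"
    and f_param :: "real \<Rightarrow> real^'n \<Rightarrow> real^'n \<Rightarrow> real^'n"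
    and lam :: complex and v :: "complex^'n"
    and \<Omega> \<epsilon> \<epsilon>\<^sub>0 r \<delta> :: real and \<eta> :: "nat \<Rightarrow> real" and \<kappa>\<^sub>0 :: int
    and W :: "real \<Rightarrow> complex \<Rightarrow> real \<Rightarrow> (real^'n) \<times> (real^'n)"
    and P :: "real \<Rightarrow> complex \<Rightarrow> real \<Rightarrow> complex"
    and R :: "nat \<times> nat \<Rightarrow> complex" and S :: "nat \<times> nat \<Rightarrow> int \<Rightarrow> complex"
  assumes nonlinearity: "purely_nonlinear f"
    and periodic_ext: "\<And>\<phi>. f_ext (\<phi> + 2 * pi) = f_ext \<phi>"
    and periodic_param: "\<And>\<phi> y u. f_param (\<phi> + 2 * pi) y u = f_param \<phi> y u"
    and frequency: "\<Omega> > 0"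
    and mode: "mech_eigenpair M C K lam v"
    and no_internal: "no_internal_resonance \<eta> \<delta> M C K lam"
    and external: "\<kappa>\<^sub>0 \<noteq> 0" "near_resonant \<eta> \<delta> lam lam \<Omega> (0, 0) \<kappa>\<^sub>0"
    and SSM: "is_SSM M C K f (\<lambda>\<phi> y u. f_ext \<phi> + f_param \<phi> y u) \<Omega> lam v \<epsilon>\<^sub>0 r W P"
    and reduced: "first_order_expansion \<epsilon>\<^sub>0 r P R S"
    and normal_form: "normal_form_style \<eta> \<delta> lam \<Omega> R S"
    and tolerance: "small_tolerance \<delta> \<Omega> S"
    and epsilon: "0 \<le> \<epsilon>" "\<epsilon> \<le> \<epsilon>\<^sub>0"
  shows
     "(\<forall>T \<rho> \<theta> \<phi>. open T \<and>
         (\<forall>t\<in>T. 0 \<le> \<rho> t \<and> \<rho> t < r \<and> \<rho> differentiable (at t) \<and> \<theta> differentiable (at t)) \<longrightarrow>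
         (reduced_solution R S \<epsilon> \<Omega> T (\<lambda>t. of_real (\<rho> t) * exp (\<i> * of_real (\<theta> t))) \<phi> \<longleftrightarrow>
          polar_solution \<kappa>\<^sub>0 R S \<epsilon> \<Omega> T \<rho> (\<lambda>t. \<theta> t - of_int \<kappa>\<^sub>0 * \<phi> t) \<and>
          (\<forall>t\<in>T. (\<phi> has_real_derivative \<Omega>) (at t within T)))) \<and>
      (\<forall>\<rho> \<psi>. 0 \<le> \<rho> \<and> \<rho> < r \<longrightarrow>
         (polar_fixed_point \<kappa>\<^sub>0 R S \<epsilon> \<Omega> \<rho> \<psi> \<longleftrightarrow> polar_r \<kappa>\<^sub>0 R S \<epsilon> \<rho> \<psi> \<Omega> = 0)) \<and>
      (\<forall>\<rho> \<psi>. 0 < \<rho> \<and> \<rho> < r \<longrightarrow>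
         (polar_field \<kappa>\<^sub>0 R S \<epsilon> \<Omega> has_derivative (\<lambda>h. polar_J \<kappa>\<^sub>0 R S \<epsilon> \<Omega> \<rho> \<psi> *v h))
           (at (vector [\<rho>, \<psi>]))) \<and>
      (\<forall>\<rho> \<psi>. 0 < \<rho> \<and> \<rho> < r \<and> polar_fixed_point \<kappa>\<^sub>0 R S \<epsilon> \<Omega> \<rho> \<psi> \<and>
         hyperbolic_at (polar_field \<kappa>\<^sub>0 R S \<epsilon> \<Omega>) (vector [\<rho>, \<psi>]) \<longrightarrow>
         (asymptotically_stable (polar_state_solution r \<kappa>\<^sub>0 R S \<epsilon> \<Omega>) (vector [\<rho>, \<psi>]) \<longleftrightarrow>
            (\<forall>\<mu>\<in>eigenvalues (polar_J \<kappa>\<^sub>0 R S \<epsilon> \<Omega> \<rho> \<psi>). Re \<mu> < 0)) \<and>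
         (\<not> lyapunov_stable (polar_state_solution r \<kappa>\<^sub>0 R S \<epsilon> \<Omega>) (vector [\<rho>, \<psi>]) \<longleftrightarrow>
            (\<exists>\<mu>\<in>eigenvalues (polar_J \<kappa>\<^sub>0 R S \<epsilon> \<Omega> \<rho> \<psi>). 0 < Re \<mu>)))"
proof -
  interpret resonant_reduced_dynamics R S \<kappa>\<^sub>0 r
  proof
    have freq: "\<delta> < \<bar>Im lam\<bar>"
      by (rule mode_frequency_exceeds_tolerance[OF frequency external tolerance])
    show "coeffs_converge r R S" using reduced by (simp add: first_order_expansion_def)
    show "\<kappa>\<^sub>0 \<noteq> 0" by (rule external(1))
    show "fst m = Suc (snd m)" if "R m \<noteq> 0" for m
      using normal_form that autonomous_resonance_exact[OF freq]
      unfolding normal_form_style_def by blast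
    show "\<kappa> = \<kappa>\<^sub>0 * (1 - int (fst m) + int (snd m))" if "\<kappa> \<noteq> 0" "S m \<kappa> \<noteq> 0" for m \<kappa>
    proof (rule forced_resonance_exact[OF frequency external(2)])
      show "near_resonant \<eta> \<delta> lam lam \<Omega> m \<kappa>"
        using normal_form that unfolding normal_form_style_def by blast
      show "(1 + \<bar>1 - real (fst m) + real (snd m)\<bar>) * \<delta> < \<Omega>"
        using tolerance that unfolding small_tolerance_def by blast
    qed
  qed
  have derivative: "(polar_field \<kappa>\<^sub>0 R S \<epsilon> \<Omega> has_derivative (\<lambda>h. polar_J \<kappa>\<^sub>0 R S \<epsilon> \<Omega> \<rho> \<psi> *v h))
      (at (vector [\<rho>, \<psi>]))" if \<rho>: "0 < \<rho>" "\<rho> < r" for \<rho> \<psi>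
  proof -
    have "0 < \<rho> / 2" "\<rho> / 2 < (\<rho> + r) / 2" "(\<rho> + r) / 2 < r" using \<rho> by auto
    from polar_field_derivative[OF this, of \<epsilon> \<Omega>]
    obtain B where "\<And>x. \<rho> / 2 < x $ 1 \<Longrightarrow> x $ 1 < (\<rho> + r) / 2 \<Longrightarrow>
        (polar_field \<kappa>\<^sub>0 R S \<epsilon> \<Omega> has_derivative (*v) (polar_J \<kappa>\<^sub>0 R S \<epsilon> \<Omega> (x $ 1) (x $ 2))) (at x) \<and>
        (\<forall>h. norm (polar_J \<kappa>\<^sub>0 R S \<epsilon> \<Omega> (x $ 1) (x $ 2) *v h) \<le> B * norm h)"
      by metis
    from this[of "vector [\<rho>, \<psi>]"] show ?thesis using \<rho> by simp
  qed
  show ?thesis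
  proof (intro conjI allI impI)
    fix T and \<rho> \<theta> \<phi> :: "real \<Rightarrow> real"
    assume "open T \<and>
      (\<forall>t\<in>T. 0 \<le> \<rho> t \<and> \<rho> t < r \<and> \<rho> differentiable (at t) \<and> \<theta> differentiable (at t))"
    thus "reduced_solution R S \<epsilon> \<Omega> T (\<lambda>t. of_real (\<rho> t) * exp (\<i> * of_real (\<theta> t))) \<phi> \<longleftrightarrow>
        polar_solution \<kappa>\<^sub>0 R S \<epsilon> \<Omega> T \<rho> (\<lambda>t. \<theta> t - of_int \<kappa>\<^sub>0 * \<phi> t) \<and>
        (\<forall>t\<in>T. (\<phi> has_real_derivative \<Omega>) (at t within T))"
      by (intro reduced_iff_polar_solution) auto
  next
    fix \<rho> \<psi> :: real
    show "polar_fixed_point \<kappa>\<^sub>0 R S \<epsilon> \<Omega> \<rho> \<psi> \<longleftrightarrow> polar_r \<kappa>\<^sub>0 R S \<epsilon> \<rho> \<psi> \<Omega> = 0"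
      by (rule polar_fixed_point_iff)
  next
    fix \<rho> \<psi> :: real assume "0 < \<rho> \<and> \<rho> < r"
    thus "(polar_field \<kappa>\<^sub>0 R S \<epsilon> \<Omega> has_derivative (\<lambda>h. polar_J \<kappa>\<^sub>0 R S \<epsilon> \<Omega> \<rho> \<psi> *v h))
        (at (vector [\<rho>, \<psi>]))"
      using derivative by blast
  next
    fix \<rho> \<psi> :: real
    assume "0 < \<rho> \<and> \<rho> < r \<and> polar_fixed_point \<kappa>\<^sub>0 R S \<epsilon> \<Omega> \<rho> \<psi> \<and>
      hyperbolic_at (polar_field \<kappa>\<^sub>0 R S \<epsilon> \<Omega>) (vector [\<rho>, \<psi>])"
    hence *: "0 < \<rho>" "\<rho> < r" "polar_fixed_point \<kappa>\<^sub>0 R S \<epsilon> \<Omega> \<rho> \<psi>"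
      "hyperbolic_at (polar_field \<kappa>\<^sub>0 R S \<epsilon> \<Omega>) (vector [\<rho>, \<psi>])" by blast+
    show "asymptotically_stable (polar_state_solution r \<kappa>\<^sub>0 R S \<epsilon> \<Omega>) (vector [\<rho>, \<psi>]) \<longleftrightarrow>
        (\<forall>\<mu>\<in>eigenvalues (polar_J \<kappa>\<^sub>0 R S \<epsilon> \<Omega> \<rho> \<psi>). Re \<mu> < 0)"
      using polar_stability[OF *] by blast
    show "\<not> lyapunov_stable (polar_state_solution r \<kappa>\<^sub>0 R S \<epsilon> \<Omega>) (vector [\<rho>, \<psi>]) \<longleftrightarrow>
        (\<exists>\<mu>\<in>eigenvalues (polar_J \<kappa>\<^sub>0 R S \<epsilon> \<Omega> \<rho> \<psi>). 0 < Re \<mu>)"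
      using polar_stability[OF *] by blast
  qed
qed

end
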